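(* Let $T\in\mathcal{A}_n[\mathbb{R}]$ be nonzero with symbol $F_T(z,w)$. If $T\in\mathcal{A}_n^s(\mathbb{R})$, then $F_T(z_1,\ldots,z_n,-w_1,\ldots,-w_n)\neq 0$ whenever $\operatorname{Im}(z_j)\ge 0$ and $\operatorname{Im}(w_k)>0$ for all $1\le j,k\le n$.
   Context: $\mathcal{A}_n[\mathbb{R}]$ is the set of operators $T=\sum_{\alpha,\beta\in\mathbb{N}^n}a_{\alpha\beta}z^\alpha\partial^\beta$ (finite sum, $\partial_i=\partial/\partial z_i$, multi-index notation, $a_{\alpha\beta}\in\mathbb{R}$); the symbol of $T$ is $F_T(z,w)=\sum_{\alpha,\beta}a_{\alpha\beta}z^\alpha w^\beta$. A polynomial $f\in\mathbb{R}[z_1,\ldots,z_n]$ is real stable if $f(z_1,\ldots,z_n)\neq 0$ whenever $\operatorname{Im}(z_j)>0$ for all $j$. $\mathcal{H}_1^s(\mathbb{R})$ is the set of nonzero real univariate polynomials with only real and simple zeros (nonzero constants included). A real stable polynomial $f\in\mathbb{R}[z_1,\ldots,z_n]$ is strictly real stable if $f(\alpha+vt)\in\mathcal{H}_1^s(\mathbb{R})$ (as a polynomial in $t$) for all $\alpha\in\mathbb{R}^n$ and $v\in\mathbb{R}_+^n$, where $\mathbb{R}_+$ denotes the positive reals; $\mathcal{H}_n^s(\mathbb{R})$ denotes the set of strictly real stable polynomials in $n$ variables. $\mathcal{A}_n^s(\mathbb{R})=\{T\in\mathcal{A}_n[\mathbb{R}]: T(\mathcal{H}_n^s(\mathbb{R}))\subseteq\mathcal{H}_n^s(\mathbb{R})\cup\{0\}\}$.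 *)

theory Defs
  imports
    "HOL-Analysis.Analysis"
    "HOL-Computational_Algebra.Polynomial"
    "HOL-Library.Poly_Mapping"
begin

text \<open>
  Polynomials in variables indexed by a finite type \<open>'n\<close> (so the number of variables is
  \<open>n = CARD('n) \<ge> 1\<close>), with real coefficients: finitely supported families of coefficients indexed by
  exponents. The ring operations are those of \<^type>\<open>poly_mapping\<close>.
\<close>

type_synonym 'n mexp = "'n \<Rightarrow>\<^sub>0 nat"
type_synonym 'n mpoly_real = "'n mexp \<Rightarrow>\<^sub>0 real"

definition mpower :: "('n::finite \<Rightarrow> 'r) \<Rightarrow> 'n mexp \<Rightarrow> 'r::comm_semiring_1" where
  "mpower x \<alpha> = (\<Prod>i\<in>UNIV. x i ^ Poly_Mapping.lookup \<alpha> i)"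

text \<open>
  The parameter \<open>h\<close> embeds the coefficients into the ring in which \<open>f\<close> is evaluated: this ring is
  the complex numbers for stability, and the real univariate polynomials for the restriction of
  \<open>f\<close> to a line.
\<close>

definition meval :: "(real \<Rightarrow> 'r) \<Rightarrow> 'n::finite mpoly_real \<Rightarrow> ('n \<Rightarrow> 'r) \<Rightarrow> 'r::comm_semiring_1" where
  "meval h f x = (\<Sum>m\<in>Poly_Mapping.keys f. h (Poly_Mapping.lookup f m) * mpower x m)"

definition restrict_line :: "'n::finite mpoly_real \<Rightarrow> real^'n \<Rightarrow> real^'n \<Rightarrow> real poly" where
  "restrict_line f a v = meval (\<lambda>c. [:c:]) f (\<lambda>i. [:a $ i, v $ i:])"

definition real_stable :: "'n::finite mpoly_real \<Rightarrow> bool" where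
  "real_stable f \<longleftrightarrow>
     (\<forall>z :: complex^'n. (\<forall>j. Im (z $ j) > 0) \<longrightarrow> meval complex_of_real f (($) z) \<noteq> 0)"

text \<open>Nonzero constants belong to \<open>H1s\<close>, as they have no zeros.\<close>

definition H1s :: "real poly set" where
  "H1s = {p. p \<noteq> 0 \<and>
     (\<forall>z :: complex. poly (map_poly complex_of_real p) z = 0 \<longrightarrow>
        z \<in> \<real> \<and> order z (map_poly complex_of_real p) = 1)}"

text \<open>The strictly real stable polynomials.\<close>

definition Hs :: "'n::finite mpoly_real set" where
  "Hs = {f. real_stable f \<and>
     (\<forall>a v. (\<forall>i. v $ i > 0) \<longrightarrow> restrict_line f a v \<in> H1s)}"

text \<open>
  The partial derivative \<open>\<partial>\<^sub>i\<close>. If \<open>i\<close> does not occur in \<open>m\<close> the truncated subtraction is harmless,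
  since the coefficient is zero.
\<close>

definition mderiv :: "'n \<Rightarrow> 'n::finite mpoly_real \<Rightarrow> 'n mpoly_real" where
  "mderiv i f = (\<Sum>m\<in>Poly_Mapping.keys f.
     Poly_Mapping.single (m - Poly_Mapping.single i 1)
       (real (Poly_Mapping.lookup m i) * Poly_Mapping.lookup f m))"

text \<open>
  \<open>\<partial>\<^sup>\<beta>\<close> is the composition of the \<open>\<partial>\<^sub>i\<close>, each iterated \<open>\<beta>\<^sub>i\<close> times; the order is immaterial as the
  \<open>\<partial>\<^sub>i\<close> commute (lemma \<open>comp_fun_commute_mderiv\<close>).
\<close>

definition mderivs :: "'n mexp \<Rightarrow> 'n::finite mpoly_real \<Rightarrow> 'n mpoly_real" where
  "mderivs \<beta> f = Finite_Set.fold (\<lambda>i. mderiv i ^^ Poly_Mapping.lookup \<beta> i) f UNIV"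

text \<open>
  A family \<open>c\<close> of coefficients \<open>a\<^sub>\<alpha>\<^sub>\<beta>\<close>, indexed by pairs \<open>(\<alpha>, \<beta>)\<close>, determines the operator
  \<open>\<Sum> a\<^sub>\<alpha>\<^sub>\<beta> z\<^sup>\<alpha> \<partial>\<^sup>\<beta>\<close>.
\<close>

definition weyl_op :: "('n mexp \<times> 'n mexp \<Rightarrow>\<^sub>0 real) \<Rightarrow> 'n::finite mpoly_real \<Rightarrow> 'n mpoly_real" where
  "weyl_op c f = (\<Sum>(\<alpha>, \<beta>)\<in>Poly_Mapping.keys c.
     Poly_Mapping.single \<alpha> (Poly_Mapping.lookup c (\<alpha>, \<beta>)) * mderivs \<beta> f)"

definition weyl_algebra :: "('n::finite mpoly_real \<Rightarrow> 'n mpoly_real) set" where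
  "weyl_algebra = range weyl_op"

text \<open>The family of coefficients of an operator is unique, see lemma \<open>weyl_coeffs_weyl_op\<close>.\<close>

definition weyl_coeffs ::
    "('n::finite mpoly_real \<Rightarrow> 'n mpoly_real) \<Rightarrow> ('n mexp \<times> 'n mexp \<Rightarrow>\<^sub>0 real)" where
  "weyl_coeffs T = (THE c. T = weyl_op c)"

definition weyl_symbol ::
    "('n::finite mpoly_real \<Rightarrow> 'n mpoly_real) \<Rightarrow> complex^'n \<Rightarrow> complex^'n \<Rightarrow> complex" where
  "weyl_symbol T z w = (\<Sum>(\<alpha>, \<beta>)\<in>Poly_Mapping.keys (weyl_coeffs T).
     complex_of_real (Poly_Mapping.lookup (weyl_coeffs T) (\<alpha>, \<beta>))
       * mpower (($) z) \<alpha> * mpower (($) w) \<beta>)"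

text \<open>The operators preserving strict real stability, up to the zero polynomial.\<close>

definition As :: "('n::finite mpoly_real \<Rightarrow> 'n mpoly_real) set" where
  "As = {T \<in> weyl_algebra. T ` Hs \<subseteq> Hs \<union> {0}}"


lemma lookup_mderiv:
  "Poly_Mapping.lookup (mderiv i f) m =
     real (Suc (Poly_Mapping.lookup m i)) * Poly_Mapping.lookup f (m + Poly_Mapping.single i 1)"
proof -
  let ?e = "Poly_Mapping.single i (1::nat)"
  have key: "real (Poly_Mapping.lookup k i) * Poly_Mapping.lookup f k = 0 \<or> (k - ?e = m \<longleftrightarrow> k = m + ?e)" for k
  proof (cases "Poly_Mapping.lookup k i = 0")
    case False
    have "k - ?e + ?e = k"
      using False by (intro poly_mapping_eqI) (auto simp: lookup_add lookup_minus lookup_single when_def)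
    then show ?thesis by (metis add_diff_cancel_right')
  qed simp
  have "Poly_Mapping.lookup (mderiv i f) m = (\<Sum>k\<in>Poly_Mapping.keys f.
      if k = m + ?e then real (Poly_Mapping.lookup k i) * Poly_Mapping.lookup f k else 0)"
    unfolding mderiv_def lookup_sum using key
    by (intro sum.cong) (auto simp: lookup_single when_def)
  also have "\<dots> = real (Suc (Poly_Mapping.lookup m i)) * Poly_Mapping.lookup f (m + ?e)"
    by (auto simp: lookup_add in_keys_iff)
  finally show ?thesis .
qed

lemma mderiv_commute: "mderiv i (mderiv j f) = mderiv j (mderiv i f)"
proof (cases "i = j")
  case False
  then show ?thesis
    by (intro poly_mapping_eqI) (simp add: lookup_mderiv lookup_add lookup_single when_def ac_simps)
qed simp

lemma comp_fun_commute_mderiv: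
  fixes \<beta> :: "'n::finite mexp"
  shows "comp_fun_commute (\<lambda>i. mderiv i ^^ Poly_Mapping.lookup \<beta> i)"
proof
  have a: "mderiv i ((mderiv j ^^ k) f) = (mderiv j ^^ k) (mderiv i f)" for i j k and f :: "'n mpoly_real"
  proof (induction k)
    case (Suc k)
    have "mderiv i ((mderiv j ^^ Suc k) f) = mderiv j (mderiv i ((mderiv j ^^ k) f))"
      using mderiv_commute[of i j "(mderiv j ^^ k) f"] by simp
    with Suc show ?case by simp
  qed simp
  have b: "(mderiv i ^^ l) ((mderiv j ^^ k) f) = (mderiv j ^^ k) ((mderiv i ^^ l) f)" for i j k l and f :: "'n mpoly_real"
    by (induction l) (auto simp: a)
  show "(mderiv j ^^ Poly_Mapping.lookup \<beta> j) \<circ> (mderiv i ^^ Poly_Mapping.lookup \<beta> i) =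
        (mderiv i ^^ Poly_Mapping.lookup \<beta> i) \<circ> (mderiv j ^^ Poly_Mapping.lookup \<beta> j)" for i j :: 'n
    by (auto simp: b)
qed

lemma mderiv_single:
  "mderiv i (Poly_Mapping.single m c) =
     Poly_Mapping.single (m - Poly_Mapping.single i 1) (real (Poly_Mapping.lookup m i) * c)"
  by (cases "c = 0") (simp_all add: mderiv_def)

lemma mderiv_funpow_single:
  "(mderiv i ^^ k) (Poly_Mapping.single m c) =
     Poly_Mapping.single (m - Poly_Mapping.single i k)
       (real (\<Prod>l<k. Poly_Mapping.lookup m i - l) * c)"
proof (induction k)
  case (Suc k)
  have "m - Poly_Mapping.single i k - Poly_Mapping.single i 1 = m - Poly_Mapping.single i (Suc k)"
    by (simp add: diff_diff_add single_add[symmetric])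
  with Suc show ?case
    by (simp add: mderiv_single lookup_minus mult_ac)
qed simp

lemma fold_mderiv_single:
  assumes "finite S"
  shows "Finite_Set.fold (\<lambda>i. mderiv i ^^ Poly_Mapping.lookup \<beta> i) (Poly_Mapping.single m c) S =
     Poly_Mapping.single (m - (\<Sum>i\<in>S. Poly_Mapping.single i (Poly_Mapping.lookup \<beta> i)))
       (real (\<Prod>i\<in>S. \<Prod>l<Poly_Mapping.lookup \<beta> i. Poly_Mapping.lookup m i - l) * c)"
  using assms
proof (induction S rule: finite_induct)
  case (insert x F)
  have "Poly_Mapping.lookup (m - (\<Sum>i\<in>F. Poly_Mapping.single i (Poly_Mapping.lookup \<beta> i))) x
      = Poly_Mapping.lookup m x"
    using insert.hyps by (auto simp: lookup_minus lookup_sum lookup_single when_def intro!: sum.neutral)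
  moreover have "Finite_Set.fold (\<lambda>i. mderiv i ^^ Poly_Mapping.lookup \<beta> i) (Poly_Mapping.single m c) (insert x F)
      = (mderiv x ^^ Poly_Mapping.lookup \<beta> x)
          (Finite_Set.fold (\<lambda>i. mderiv i ^^ Poly_Mapping.lookup \<beta> i) (Poly_Mapping.single m c) F)"
    by (rule comp_fun_commute_on.fold_insert[OF comp_fun_commute_mderiv[unfolded comp_fun_commute_def'] subset_UNIV])
      (use insert.hyps in auto)
  ultimately show ?case
    by (simp only: insert.IH mderiv_funpow_single diff_diff_add sum.insert[OF insert.hyps]
        prod.insert[OF insert.hyps] of_nat_mult mult.assoc
        add.commute[of "Poly_Mapping.single x _"])
qed simp

lemma mexp_eq_sum_single:
  "(\<Sum>i\<in>UNIV. Poly_Mapping.single i (Poly_Mapping.lookup \<beta> i)) = (\<beta> :: 'n::finite mexp)"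
  by (intro poly_mapping_eqI) (simp add: lookup_sum lookup_single when_def)

lemma mderivs_single:
  "mderivs \<beta> (Poly_Mapping.single m c) =
     Poly_Mapping.single (m - \<beta>)
       (real (\<Prod>i\<in>UNIV. \<Prod>l<Poly_Mapping.lookup \<beta> i. Poly_Mapping.lookup m i - l) * c)"
  unfolding mderivs_def by (simp only: fold_mderiv_single[OF finite_class.finite_UNIV] mexp_eq_sum_single)

lemma weyl_op_superset:
  assumes "finite S" "Poly_Mapping.keys c \<subseteq> S"
  shows "weyl_op c f = (\<Sum>(\<alpha>, \<beta>)\<in>S.
     Poly_Mapping.single \<alpha> (Poly_Mapping.lookup c (\<alpha>, \<beta>)) * mderivs \<beta> f)"
  unfolding weyl_op_def using assms
  by (intro sum.mono_neutral_left) (auto simp: in_keys_iff)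

lemma weyl_op_diff: "weyl_op (c - d) f = weyl_op c f - weyl_op d f"
proof -
  let ?S = "Poly_Mapping.keys c \<union> Poly_Mapping.keys d"
  have "Poly_Mapping.keys (c - d) \<subseteq> ?S"
    by (auto simp: in_keys_iff lookup_minus)
  then show ?thesis
    by (simp add: weyl_op_superset[of ?S] sum_subtractf[symmetric] lookup_minus single_diff
        left_diff_distrib case_prod_unfold)
qed

lemma weyl_op_eq_0:
  assumes "\<And>f. weyl_op c f = 0"
  shows "c = 0"
proof (rule ccontr)
  assume "c \<noteq> 0"
  then have "\<exists>p. p \<in> Poly_Mapping.keys c"
    by (metis in_keys_iff lookup_zero poly_mapping_eqI)
  then obtain p where p: "p \<in> Poly_Mapping.keys c"
    and pmin: "\<And>q. q \<in> Poly_Mapping.keys c \<Longrightarrow>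
      (\<Sum>i\<in>UNIV. Poly_Mapping.lookup (snd p) i) \<le> (\<Sum>i\<in>UNIV. Poly_Mapping.lookup (snd q) i)"
    using exists_least_iff[of "\<lambda>n. \<exists>p\<in>Poly_Mapping.keys c. n = (\<Sum>i\<in>UNIV. Poly_Mapping.lookup (snd p) i)"]
    by (metis linorder_not_less)
  obtain a b where ab: "p = (a, b)" by (cases p)
  define C where "C \<beta> = real (\<Prod>i\<in>UNIV. \<Prod>l<Poly_Mapping.lookup \<beta> i. Poly_Mapping.lookup b i - l)" for \<beta>
  have ms: "mderivs \<beta> (Poly_Mapping.single b 1) = Poly_Mapping.single (b - \<beta>) (C \<beta>)" for \<beta>
    by (simp only: mderivs_single C_def mult_1_right)
  have Cb: "C b \<noteq> 0" by (simp add: C_def)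
  have C0: "C \<beta> = 0" if k: "(\<alpha>, \<beta>) \<in> Poly_Mapping.keys c" and ne: "\<beta> \<noteq> b" for \<alpha> \<beta>
  proof -
    have "\<exists>i. Poly_Mapping.lookup b i < Poly_Mapping.lookup \<beta> i"
    proof (rule ccontr)
      assume n: "\<not> ?thesis"
      obtain j where j: "Poly_Mapping.lookup \<beta> j \<noteq> Poly_Mapping.lookup b j"
        using ne by (metis poly_mapping_eqI)
      have le: "Poly_Mapping.lookup \<beta> i \<le> Poly_Mapping.lookup b i" for i
        using n by (simp add: not_less)
      have "(\<Sum>i\<in>UNIV. Poly_Mapping.lookup \<beta> i) < (\<Sum>i\<in>UNIV. Poly_Mapping.lookup b i)"
        using le j le_neq_trans by (intro sum_strict_mono_ex1) (simp, simp, blast)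
      with pmin[OF k] ab show False by simp
    qed
    then obtain i where "Poly_Mapping.lookup b i < Poly_Mapping.lookup \<beta> i" ..
    then have "(\<Prod>l<Poly_Mapping.lookup \<beta> i. Poly_Mapping.lookup b i - l) = 0"
      by (intro prod_zero) auto
    then have "(\<Prod>i\<in>UNIV. \<Prod>l<Poly_Mapping.lookup \<beta> i. Poly_Mapping.lookup b i - l) = 0"
      by (intro prod_zero) auto
    then show ?thesis by (simp add: C_def)
  qed
  have "0 = Poly_Mapping.lookup (weyl_op c (Poly_Mapping.single b 1)) a"
    using assms by simp
  also have "\<dots> = (\<Sum>q\<in>Poly_Mapping.keys c. if q = (a, b) then Poly_Mapping.lookup c q * C b else 0)"
    unfolding weyl_op_def lookup_sum
  proof (intro sum.cong refl)
    fix q assume q: "q \<in> Poly_Mapping.keys c"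
    obtain \<alpha> \<beta> where q': "q = (\<alpha>, \<beta>)" by (cases q)
    show "Poly_Mapping.lookup (case q of (\<alpha>, \<beta>) \<Rightarrow> Poly_Mapping.single \<alpha> (Poly_Mapping.lookup c (\<alpha>, \<beta>))
        * mderivs \<beta> (Poly_Mapping.single b 1)) a =
        (if q = (a, b) then Poly_Mapping.lookup c q * C b else 0)"
      using C0[of \<alpha> \<beta>] q q'
      by (cases "\<beta> = b") (auto simp: ms mult_single lookup_single when_def)
  qed
  also have "\<dots> = Poly_Mapping.lookup c (a, b) * C b"
    using p ab by simp
  finally show False
    using Cb p ab by (simp add: in_keys_iff)
qed

lemma inj_weyl_op: "inj weyl_op"
proof (rule injI)
  fix c d :: "'n::finite mexp \<times> 'n mexp \<Rightarrow>\<^sub>0 real"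
  assume "weyl_op c = weyl_op d"
  then have "c - d = 0" by (intro weyl_op_eq_0) (simp add: weyl_op_diff)
  then show "c = d" by simp
qed

lemma weyl_coeffs_weyl_op [simp]: "weyl_coeffs (weyl_op c) = c"
  unfolding weyl_coeffs_def using inj_weyl_op by (auto simp: inj_def)

end

theory Submission
  imports Defs "HOL-Complex_Analysis.Great_Picard" "HOL-Computational_Algebra.Fundamental_Theorem_Algebra"
begin

text \<open>
  Let \<open>h = p + iq\<close> be a nonconstant complex polynomial without zeros in the closed upper half-space. By
  Hermite--Biehler every real combination \<open>ap + bq\<close> is strictly real stable, so every \<open>aTp + bTq\<close> is
  strictly real stable or zero. If \<open>Th = Tp + iTq\<close> has a zero in the lower half-space, then it
  has no zero \<open>z\<close> in the closed upper half-space, unless \<open>Th = 0\<close>: for interior \<open>z\<close>, the quotient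
  \<open>Tp / Tq\<close> would take the values \<open>-i\<close> and \<open>i\<close> in the upper half-space, and so a real value in between;
  for real \<open>z\<close>, some \<open>aTp + bTq\<close> would have a double zero on a line through \<open>z\<close>; the mixed case
  reduces to the real one by Hurwitz's theorem.

  Now suppose that the symbol vanishes at \<open>(z, -w)\<close>. Up to a factor, \<open>F\<^sub>T(z, -w)\<close> is the limit of
  \<open>Th\<^sub>N(z)\<close> for \<open>h\<^sub>N(x) = \<Prod>\<^sub>i (1 - (x\<^sub>i - z\<^sub>i) w\<^sub>i / N) ^ N\<close>, so by Hurwitz's theorem \<open>Th\<^sub>N(z) = 0\<close> for some
  large \<open>N\<close> after moving \<open>w\<close>. As \<open>Th\<^sub>N\<close> inherits zeros in the lower half-space from the high multiplicity
  of the factors, \<open>Th\<^sub>N = 0\<close>. The same applies to \<open>h\<^sub>N + \<epsilon>g\<close>, where \<open>g\<close> shares factors with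
  \<open>h\<^sub>N\<close>, has degree at most \<open>N\<close> in each variable, and vanishes to high order at \<open>z\<close>. Hence \<open>Tg = 0\<close>,
  which fails for a suitable \<open>g\<close>.
\<close>

subsection \<open>Evaluation\<close>

abbreviation ceval :: "'n::finite mpoly_real \<Rightarrow> ('n \<Rightarrow> complex) \<Rightarrow> complex" where
  "ceval \<equiv> meval complex_of_real"

lemma meval_superset:
  assumes "finite S" "Poly_Mapping.keys f \<subseteq> S" "h 0 = 0"
  shows "meval h f x = (\<Sum>m\<in>S. h (Poly_Mapping.lookup f m) * mpower x m)"
  unfolding meval_def using assms by (intro sum.mono_neutral_left) (auto simp: in_keys_iff)

lemma ceval_0 [simp]: "ceval 0 x = 0"
  by (simp add: meval_def)

lemma ceval_add: "ceval (f + g) x = ceval f x + ceval g x"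
proof -
  let ?S = "Poly_Mapping.keys f \<union> Poly_Mapping.keys g"
  have "Poly_Mapping.keys (f + g) \<subseteq> ?S" by (rule keys_add)
  then show ?thesis
    by (simp add: meval_superset[of ?S] lookup_add sum.distrib distrib_right)
qed

lemma ceval_sum: "ceval (sum f A) x = (\<Sum>a\<in>A. ceval (f a) x)"
  by (induction A rule: infinite_finite_induct) (auto simp: ceval_add)

lemma ceval_single [simp]: "ceval (Poly_Mapping.single m r) x = of_real r * mpower x m"
  by (cases "r = 0") (auto simp: meval_def)

lemma mpower_add: "mpower x (a + b) = mpower x a * mpower x b"
  by (simp add: mpower_def lookup_add power_add prod.distrib)

lemma sum_single_lookup: "f = (\<Sum>m\<in>Poly_Mapping.keys f. Poly_Mapping.single m (Poly_Mapping.lookup f m))"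
  by (intro poly_mapping_eqI) (auto simp: lookup_sum lookup_single when_def in_keys_iff)

lemma ceval_single_mult:
  "ceval (Poly_Mapping.single a r * f) x = of_real r * mpower x a * ceval f x"
proof -
  have "Poly_Mapping.single a r * f
      = (\<Sum>m\<in>Poly_Mapping.keys f. Poly_Mapping.single (a + m) (r * Poly_Mapping.lookup f m))"
    by (subst (1) sum_single_lookup[of f]) (simp add: sum_distrib_left mult_single)
  then show ?thesis
    by (simp add: ceval_sum mpower_add meval_def[of _ f] sum_distrib_left mult_ac)
qed

lemma ceval_cnj: "ceval f (\<lambda>i. cnj (x i)) = cnj (ceval f x)"
  by (simp add: meval_def mpower_def)

lemma continuous_on_ceval [continuous_intros]:
  assumes "\<And>i. continuous_on S (\<lambda>s. x s i)"
  shows "continuous_on S (\<lambda>s. ceval f (x s))"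
  unfolding meval_def mpower_def by (intro continuous_intros assms)

lemma holomorphic_on_ceval [holomorphic_intros]:
  assumes "\<And>i. (\<lambda>s. x s i) holomorphic_on S"
  shows "(\<lambda>s. ceval f (x s)) holomorphic_on S"
  unfolding meval_def mpower_def by (intro holomorphic_intros assms)

lemma poly_of_real: "poly (map_poly complex_of_real p) (of_real t) = of_real (poly p t)"
  by (induction p) (simp_all add: map_poly_pCons)

lemma poly_eq_of_real:
  fixes p q :: "complex poly"
  assumes "\<And>t::real. poly p (of_real t) = poly q (of_real t)"
  shows "p = q"
proof -
  have "range complex_of_real \<subseteq> {t. poly (p - q) t = 0}" using assms by auto
  moreover have "infinite (range complex_of_real)"
    by (simp add: finite_image_iff inj_on_def infinite_UNIV_char_0)
  ultimately show ?thesis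
    using poly_roots_finite[of "p - q"] finite_subset by (metis eq_iff_diff_eq_0)
qed

subsection \<open>Differential operators on separated polynomials\<close>

lemma mderiv_add: "mderiv i (f + g) = mderiv i f + mderiv i g"
  by (intro poly_mapping_eqI) (simp add: lookup_mderiv lookup_add ring_distribs)

lemma mderiv_funpow_add: "(mderiv i ^^ k) (f + g) = (mderiv i ^^ k) f + (mderiv i ^^ k) g"
  by (induction k) (simp_all add: mderiv_add)

lemma mderivs_add: "mderivs \<beta> (f + g) = mderivs \<beta> f + mderivs \<beta> (g :: 'n::finite mpoly_real)"
proof -
  have "Finite_Set.fold (\<lambda>i. mderiv i ^^ Poly_Mapping.lookup \<beta> i) (f + g) S =
      Finite_Set.fold (\<lambda>i. mderiv i ^^ Poly_Mapping.lookup \<beta> i) f S +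
      Finite_Set.fold (\<lambda>i. mderiv i ^^ Poly_Mapping.lookup \<beta> i) g S"
    if "finite S" for S :: "'n set"
    using that
  proof (induction S rule: finite_induct)
    case (insert x F)
    note fi = comp_fun_commute_on.fold_insert[OF comp_fun_commute_mderiv[unfolded comp_fun_commute_def'] subset_UNIV]
    show ?case
      by (simp only: fi[OF insert.hyps] insert.IH mderiv_funpow_add)
  qed simp
  then show ?thesis by (simp add: mderivs_def)
qed

lemma mderivs_0 [simp]: "mderivs \<beta> 0 = 0"
  using mderivs_single[of \<beta> 0 0] by simp

lemma mderivs_sum: "mderivs \<beta> (sum f A) = (\<Sum>a\<in>A. mderivs \<beta> (f a))"
  by (induction A rule: infinite_finite_induct) (simp_all add: mderivs_add)

lemma ceval_weyl_op:
  "ceval (weyl_op c f) x = (\<Sum>(\<alpha>, \<beta>)\<in>Poly_Mapping.keys c.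
     of_real (Poly_Mapping.lookup c (\<alpha>, \<beta>)) * mpower x \<alpha> * ceval (mderivs \<beta> f) x)"
  unfolding weyl_op_def ceval_sum by (intro sum.cong) (auto simp: ceval_single_mult)

definition mono_deriv :: "'n::finite mexp \<Rightarrow> 'n mexp \<Rightarrow> ('n \<Rightarrow> complex) \<Rightarrow> complex" where
  "mono_deriv \<beta> m x = (\<Prod>i\<in>UNIV. poly ((pderiv ^^ Poly_Mapping.lookup \<beta> i) (monom 1 (Poly_Mapping.lookup m i))) (x i))"

lemma funpow_pderiv_monom:
  "(pderiv ^^ b) (monom c k) = monom (of_nat (\<Prod>l<b. k - l) * c) (k - b)"
  for c :: "'a::idom"
  by (induction b) (simp_all add: pderiv_monom mult_ac)

lemma ceval_mderivs_single: "ceval (mderivs \<beta> (Poly_Mapping.single m r)) x = of_real r * mono_deriv \<beta> m x"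
  by (simp add: mderivs_single mono_deriv_def funpow_pderiv_monom poly_monom mpower_def lookup_minus
      prod.distrib)

text \<open>The value at \<open>x\<close> of the operator applied to the monomial with exponent
  \<open>m\<close>. Complex combinations of these values extend the operator to complex polynomials,
  which are given only by their coefficient families.\<close>

definition weyl_mono :: "('n mexp \<times> 'n mexp \<Rightarrow>\<^sub>0 real) \<Rightarrow> 'n::finite mexp \<Rightarrow> ('n \<Rightarrow> complex) \<Rightarrow> complex" where
  "weyl_mono c m x = (\<Sum>(\<alpha>, \<beta>)\<in>Poly_Mapping.keys c.
     of_real (Poly_Mapping.lookup c (\<alpha>, \<beta>)) * mpower x \<alpha> * mono_deriv \<beta> m x)"

text \<open>The polynomial whose values at real points are the real parts of those of the complex
  polynomial with coefficients \<open>C\<close>. Other real combinations of real and imaginary part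
  arise by multiplying \<open>C\<close> by a constant.\<close>

definition re_mpoly :: "'n::finite mexp set \<Rightarrow> ('n mexp \<Rightarrow> complex) \<Rightarrow> 'n mpoly_real" where
  "re_mpoly M C = (\<Sum>m\<in>M. Poly_Mapping.single m (Re (C m)))"

lemma ceval_weyl_op_re_mpoly:
  "ceval (weyl_op c (re_mpoly M C)) x = (\<Sum>m\<in>M. of_real (Re (C m)) * weyl_mono c m x)"
proof -
  have "ceval (weyl_op c (re_mpoly M C)) x = (\<Sum>p\<in>Poly_Mapping.keys c. \<Sum>m\<in>M.
      of_real (Poly_Mapping.lookup c p) * mpower x (fst p) * (of_real (Re (C m)) * mono_deriv (snd p) m x))"
    by (simp add: ceval_weyl_op re_mpoly_def mderivs_sum ceval_sum ceval_mderivs_single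
        case_prod_unfold sum_distrib_left)
  also have "\<dots> = (\<Sum>m\<in>M. of_real (Re (C m)) * weyl_mono c m x)"
    by (subst sum.swap) (simp add: weyl_mono_def case_prod_unfold sum_distrib_left mult_ac)
  finally show ?thesis .
qed

definition box :: "nat \<Rightarrow> 'n::finite mexp set" where
  "box d = {m. \<forall>i. Poly_Mapping.lookup m i \<le> d}"

text \<open>The coefficient of the monomial with exponent \<open>m\<close> in the product of the
  \<open>P i\<close>, each taken in its own variable.\<close>

definition sep_coeff :: "('n::finite \<Rightarrow> complex poly) \<Rightarrow> 'n mexp \<Rightarrow> complex" where
  "sep_coeff P m = (\<Prod>i\<in>UNIV. coeff (P i) (Poly_Mapping.lookup m i))"

lemma lookup_Abs_finite [simp]:
  "Poly_Mapping.lookup (Abs_poly_mapping (f :: 'n::finite \<Rightarrow> nat)) = f"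
  by (rule lookup_Abs_poly_mapping) simp

lemma sum_box:
  "(\<Sum>m\<in>box d. \<Prod>i\<in>UNIV. F i (Poly_Mapping.lookup m i)) = (\<Prod>i\<in>UNIV. \<Sum>k\<le>d. F i k)"
  for F :: "'n::finite \<Rightarrow> nat \<Rightarrow> complex"
proof -
  have "(\<Prod>i\<in>UNIV. \<Sum>k\<le>d. F i k) = (\<Sum>g\<in>PiE UNIV (\<lambda>_. {..d}). \<Prod>i\<in>UNIV. F i (g i))"
    by (rule prod_sum_PiE) auto
  also have "\<dots> = (\<Sum>m\<in>box d. \<Prod>i\<in>UNIV. F i (Poly_Mapping.lookup m i))"
    by (rule sum.reindex_bij_witness[of _ Poly_Mapping.lookup Abs_poly_mapping])
      (auto simp: box_def PiE_def Pi_def)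
  finally show ?thesis by simp
qed

lemma sum_sep_coeff_mono_deriv:
  assumes "\<And>i. degree (P i) \<le> d"
  shows "(\<Sum>m\<in>box d. sep_coeff P m * mono_deriv \<beta> m x) =
    (\<Prod>i\<in>UNIV. poly ((pderiv ^^ Poly_Mapping.lookup \<beta> i) (P i)) (x i))"
proof -
  have "poly ((pderiv ^^ b) (P i)) t = (\<Sum>k\<le>d. coeff (P i) k * poly ((pderiv ^^ b) (monom 1 k)) t)" for i b t
  proof -
    have "P i = (\<Sum>k\<le>d. monom (coeff (P i) k) k)"
      using poly_as_sum_of_monoms'[OF assms] by simp
    then have "(pderiv ^^ b) (P i) = (\<Sum>k\<le>d. (pderiv ^^ b) (monom (coeff (P i) k) k))"
      by (metis higher_pderiv_sum)
    also have "\<dots> = (\<Sum>k\<le>d. smult (coeff (P i) k) ((pderiv ^^ b) (monom 1 k)))"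
      by (simp add: funpow_pderiv_monom smult_monom mult.commute)
    finally show ?thesis by (simp add: poly_sum)
  qed
  then show ?thesis
    by (simp add: sum_box[symmetric] sep_coeff_def mono_deriv_def prod.distrib)
qed

lemma sum_sep_coeff_mpower:
  assumes "\<And>i. degree (P i) \<le> d"
  shows "(\<Sum>m\<in>box d. sep_coeff P m * mpower x m) = (\<Prod>i\<in>UNIV. poly (P i) (x i))"
  using sum_sep_coeff_mono_deriv[OF assms, where \<beta> = 0 and x = x] by (simp add: mono_deriv_def mpower_def poly_monom)

lemma sum_sep_coeff_weyl_mono:
  assumes "\<And>i. degree (P i) \<le> d"
  shows "(\<Sum>m\<in>box d. sep_coeff P m * weyl_mono c m x) = (\<Sum>p\<in>Poly_Mapping.keys c.
    of_real (Poly_Mapping.lookup c p) * mpower x (fst p) *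
      (\<Prod>i\<in>UNIV. poly ((pderiv ^^ Poly_Mapping.lookup (snd p) i) (P i)) (x i)))"
  unfolding sum_sep_coeff_mono_deriv[OF assms, symmetric] weyl_mono_def sum_distrib_left case_prod_unfold
  by (subst sum.swap) (simp add: mult_ac)

subsection \<open>Hermite--Biehler\<close>

text \<open>Each factor grows: a root \<open>a\<close> below the real axis is closer to
  \<open>cnj t\<close> than to \<open>t\<close>, the squared distances differing by
  \<open>- 4 * Im t * Im a\<close>.\<close>

lemma prod_mset_cnj_less:
  assumes "\<And>a. a \<in># A \<Longrightarrow> Im a < 0" "A \<noteq> {#}" "Im t > 0"
  shows "cmod (\<Prod>a\<in>#A. cnj t - a) < cmod (\<Prod>a\<in>#A. t - a)"
  using assms(1,2)
proof (induction A)
  case (add a A)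
  have "(cmod (cnj t - a))\<^sup>2 < (cmod (t - a))\<^sup>2"
  proof -
    have "Im t * Im a < 0" using add.prems(1)[of a] assms(3) by (simp add: mult_pos_neg)
    then show ?thesis unfolding cmod_power2 by (simp add: power2_eq_square algebra_simps)
  qed
  then have less: "cmod (cnj t - a) < cmod (t - a)"
    by (simp add: power_less_imp_less_base)
  show ?case
  proof (cases "A = {#}")
    case False
    then show ?thesis using add less by (auto simp: norm_mult intro!: mult_strict_mono')
  qed (use less in simp)
qed simp

text \<open>The logarithmic derivative is the sum of all \<open>1 / (t - a)\<close>, and each
  summand has negative imaginary part because \<open>t - a\<close> lies in the upper
  half-plane.\<close>

lemma prod_mset_logderiv:
  assumes "\<And>a. a \<in># A \<Longrightarrow> Im a < 0" "A \<noteq> {#}" "Im t = 0"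
  shows "(\<Prod>a\<in>#A. t - a) \<noteq> 0 \<and> Im (poly (pderiv (\<Prod>a\<in>#A. [:- a, 1:])) t / (\<Prod>a\<in>#A. t - a)) < 0"
  using assms(1,2)
proof (induction A)
  case (add a A)
  have a: "Im (t - a) > 0" using add.prems(1)[of a] assms(3) by simp
  then have ta: "t - a \<noteq> 0" by force
  have ia: "Im (1 / (t - a)) < 0"
    using a ta by (simp add: Im_divide divide_neg_pos sum_power2_gt_zero_iff complex_eq_iff)
  show ?case
  proof (cases "A = {#}")
    case True
    then show ?thesis using ta ia by (simp add: pderiv_pCons)
  next
    case False
    define B where "B = (\<Prod>a\<in>#A. t - a)"
    define B' where "B' = poly (pderiv (\<Prod>a\<in>#A. [:- a, 1:])) t"
    have IH: "B \<noteq> 0" "Im (B' / B) < 0" using add False by (auto simp: B_def B'_def)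
    have "poly (\<Prod>a\<in>#A. [:- a, 1:]) t = B" by (simp add: B_def poly_prod_mset)
    then have "poly (pderiv (\<Prod>a\<in>#add_mset a A. [:- a, 1:])) t = (t - a) * B' + B"
      by (simp only: image_mset_add_mset prod_mset.add_mset pderiv_mult)
        (simp add: pderiv_pCons B'_def algebra_simps)
    then have "poly (pderiv (\<Prod>a\<in>#add_mset a A. [:- a, 1:])) t / ((t - a) * B) = B' / B + 1 / (t - a)"
      using IH ta by (simp add: field_simps)
    then show ?thesis using IH ta ia by (simp add: B_def[symmetric])
  qed
qed simp

text \<open>\<open>H\<close> splits into linear factors with roots below the real axis, and its
  leading coefficient cancels in both comparisons. For a constant \<open>H\<close> both would be
  equalities, hence the assumption that a root exists.\<close>

lemma hermite_biehler:
  fixes H :: "complex poly"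
  assumes "\<And>t. Im t \<ge> 0 \<Longrightarrow> poly H t \<noteq> 0" "\<exists>t. poly H t = 0"
  shows "Im t > 0 \<Longrightarrow> cmod (poly H (cnj t)) < cmod (poly H t)"
    and "Im t = 0 \<Longrightarrow> Im (poly (pderiv H) t / poly H t) < 0"
proof -
  have H: "smult (lead_coeff H) (\<Prod>x\<in>#proots H. [:-x, 1:]) = H"
    by (rule complex_poly_decompose_multiset)
  have "H \<noteq> 0" using assms(1)[of 0] by auto
  then have l: "lead_coeff H \<noteq> 0" and A: "\<And>a. a \<in># proots H \<Longrightarrow> Im a < 0" "proots H \<noteq> {#}"
  proof -
    show "lead_coeff H \<noteq> 0" using \<open>H \<noteq> 0\<close> by simp
    have iff: "a \<in># proots H \<longleftrightarrow> poly H a = 0" for a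
      by (simp add: set_count_proots[OF \<open>H \<noteq> 0\<close>])
    show "Im a < 0" if "a \<in># proots H" for a
      using that assms(1)[of a] by (auto simp: iff not_le[symmetric])
    show "proots H \<noteq> {#}" using assms(2) iff by fastforce
  qed
  have p: "poly H t = lead_coeff H * (\<Prod>a\<in>#proots H. t - a)" for t
  proof -
    have "poly H t = poly (smult (lead_coeff H) (\<Prod>x\<in>#proots H. [:-x, 1:])) t" by (simp only: H)
    then show ?thesis by (simp add: poly_prod_mset)
  qed
  have p': "poly (pderiv H) t = lead_coeff H * poly (pderiv (\<Prod>x\<in>#proots H. [:-x, 1:])) t" for t
  proof -
    have "pderiv H = pderiv (smult (lead_coeff H) (\<Prod>x\<in>#proots H. [:-x, 1:]))" by (simp only: H)
    then show ?thesis by (simp add: pderiv_smult)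
  qed
  show "cmod (poly H (cnj t)) < cmod (poly H t)" if "Im t > 0"
    using prod_mset_cnj_less[OF A that] l by (simp add: p norm_mult)
  show "Im (poly (pderiv H) t / poly H t) < 0" if "Im t = 0"
  proof -
    have "poly (pderiv H) t / poly H t =
        poly (pderiv (\<Prod>a\<in>#proots H. [:- a, 1:])) t / (\<Prod>a\<in>#proots H. t - a)"
      unfolding p[of t] p'[of t] using l by (rule mult_divide_mult_cancel_left)
    then show ?thesis using prod_mset_logderiv[OF A that] by presburger
  qed
qed

lemma pderiv_map_poly_cnj: "pderiv (map_poly cnj p) = map_poly cnj (pderiv p)"
  by (rule poly_eqI) (simp add: coeff_pderiv coeff_map_poly)

text \<open>The last assumption says that \<open>p\<close> is the real part of \<open>H\<close> on the real axis.\<close>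

lemma hermite_biehler_H1s:
  fixes H :: "complex poly" and p :: "real poly"
  assumes H: "\<And>t. Im t \<ge> 0 \<Longrightarrow> poly H t \<noteq> 0" "\<exists>t. poly H t = 0"
    and p: "\<And>t. 2 * poly (map_poly of_real p) t = poly H t + cnj (poly H (cnj t))"
  shows "Im t > 0 \<Longrightarrow> poly (map_poly of_real p) t \<noteq> 0" and "p \<in> H1s"
proof -
  let ?p = "map_poly complex_of_real p"
  show nz: "poly ?p t \<noteq> 0" if "Im t > 0" for t
  proof
    assume "poly ?p t = 0"
    then have "poly H t = - cnj (poly H (cnj t))" using p[of t] by (simp add: eq_neg_iff_add_eq_0)
    then have "cmod (poly H t) = cmod (poly H (cnj t))" by simp
    then show False using hermite_biehler(1)[OF H that] by simp
  qed
  have real: "Im t = 0" if "poly ?p t = 0" for t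
  proof (rule ccontr)
    assume "Im t \<noteq> 0"
    moreover have "poly ?p (cnj t) = 0"
    proof -
      have "2 * poly ?p (cnj t) = cnj (2 * poly ?p t)"
        unfolding p by simp
      then show ?thesis using that by simp
    qed
    ultimately show False using nz[of t] nz[of "cnj t"] that by (cases "Im t > 0") auto
  qed
  have eq: "smult 2 ?p = H + map_poly cnj H"
    by (rule poly_eq_of_real) (simp add: p)
  \<comment> \<open>At a double root, necessarily real, \<open>H\<close> and its derivative would
    both have real part zero, so their quotient would be real.\<close>
  have "rsquarefree ?p"
    unfolding rsquarefree_roots
  proof (intro allI notI)
    fix t assume t: "poly ?p t = 0 \<and> poly (pderiv ?p) t = 0"
    then have t0: "Im t = 0" using real by blast
    then have ct: "cnj t = t" by (simp add: complex_eq_iff)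
    have "poly (pderiv (smult 2 ?p)) t = 0" using t by (simp add: pderiv_smult)
    then have "Re (poly (pderiv H) t) = 0"
      by (simp add: eq pderiv_add pderiv_map_poly_cnj ct complex_eq_iff)
    moreover have "Re (poly H t) = 0"
      using t p[of t] by (simp add: ct complex_eq_iff)
    ultimately have "Im (poly (pderiv H) t / poly H t) = 0"
      by (simp add: Im_divide)
    with hermite_biehler(2)[OF H t0] show False by simp
  qed
  moreover have "poly ?p \<i> \<noteq> 0" by (rule nz) simp
  ultimately have "p \<noteq> 0" "\<And>z. order z ?p = 0 \<or> order z ?p = 1"
    by (auto simp: rsquarefree_def)
  moreover have "order z ?p \<noteq> 0" if "poly ?p z = 0" for z
    using that \<open>poly ?p \<i> \<noteq> 0\<close> by (auto simp: order_root)
  ultimately show "p \<in> H1s"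
    using real unfolding H1s_def complex_is_Real_iff by blast
qed

lemma poly_restrict_line:
  "poly (map_poly of_real (restrict_line f a v)) t = ceval f (\<lambda>i. of_real (a $ i) + of_real (v $ i) * t)"
proof -
  define G where "G = (\<Sum>m\<in>Poly_Mapping.keys f. smult (complex_of_real (Poly_Mapping.lookup f m))
    (mpower (\<lambda>i. [:of_real (a $ i), of_real (v $ i):]) m))"
  have G: "poly G t = ceval f (\<lambda>i. of_real (a $ i) + of_real (v $ i) * t)" for t
    by (simp add: G_def meval_def mpower_def poly_sum poly_prod mult_ac)
  have "map_poly of_real (restrict_line f a v) = G"
    by (rule poly_eq_of_real)
      (simp add: poly_of_real G restrict_line_def meval_def mpower_def poly_sum poly_prod mult_ac)
  then show ?thesis by (simp add: G)
qed

text \<open>Coefficientwise this is \<open>2 * Re c = c + cnj c\<close>. On lines it supplies the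
  last assumption of \<open>hermite_biehler_H1s\<close>.\<close>

lemma ceval_re_mpoly:
  assumes "h = (\<lambda>x. \<Sum>m\<in>M. C m * mpower x m)"
  shows "2 * ceval (re_mpoly M C) x = h x + cnj (h (\<lambda>i. cnj (x i)))"
proof -
  have Re: "2 * complex_of_real (Re c) = c + cnj c" for c by (simp add: complex_eq_iff)
  have "2 * ceval (re_mpoly M C) x = (\<Sum>m\<in>M. (2 * of_real (Re (C m))) * mpower x m)"
    by (simp add: re_mpoly_def ceval_sum sum_distrib_left mult.assoc)
  also have "\<dots> = (\<Sum>m\<in>M. C m * mpower x m) + (\<Sum>m\<in>M. cnj (C m) * mpower x m)"
    unfolding Re by (simp add: distrib_right sum.distrib)
  also have "(\<Sum>m\<in>M. cnj (C m) * mpower x m) = cnj (h (\<lambda>i. cnj (x i)))"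
    by (simp add: assms mpower_def)
  finally show ?thesis by (simp add: assms)
qed

text \<open>Lines with positive direction map the closed upper half-plane into the closed upper
  half-space, so Hermite--Biehler applies on each of them; \<open>lz\<close> excludes that
  \<open>h\<close> is constant there. Every point of the open upper half-space lies on such a line,
  at parameter \<open>\<i>\<close>.\<close>

lemma re_mpoly_in_Hs:
  fixes C :: "'n::finite mexp \<Rightarrow> complex"
  assumes h: "h = (\<lambda>x. \<Sum>m\<in>M. C m * mpower x m)"
    and nz: "\<And>x. (\<And>i. Im (x i) \<ge> 0) \<Longrightarrow> h x \<noteq> 0"
    and lz: "\<And>a v :: real^'n. (\<And>i. v $ i > 0) \<Longrightarrow> \<exists>t. h (\<lambda>i. of_real (a $ i) + of_real (v $ i) * t) = 0"
  shows "re_mpoly M C \<in> Hs"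
proof -
  let ?l = "\<lambda>(a :: real^'n) v t i. complex_of_real (a $ i) + of_real (v $ i) * t"
  have line: "(Im t > 0 \<longrightarrow> ceval (re_mpoly M C) (?l a v t) \<noteq> 0) \<and> restrict_line (re_mpoly M C) a v \<in> H1s"
    if v: "\<And>i. v $ i > 0" for a v t
  proof -
    define H where "H = (\<Sum>m\<in>M. smult (C m) (mpower (\<lambda>i. [:of_real (a $ i), of_real (v $ i):]) m))"
    have H: "poly H t = h (?l a v t)" for t
      by (simp add: H_def h mpower_def poly_sum poly_prod mult_ac)
    have "poly H t \<noteq> 0" if "Im t \<ge> 0" for t
      unfolding H using v that by (intro nz) (simp add: less_imp_le)
    moreover have "\<exists>t. poly H t = 0" unfolding H using v by (rule lz)
    moreover have "2 * poly (map_poly of_real (restrict_line (re_mpoly M C) a v)) t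
        = poly H t + cnj (poly H (cnj t))" for t
      by (simp add: poly_restrict_line ceval_re_mpoly[OF h] H)
    ultimately show ?thesis
      using hermite_biehler_H1s[of H "restrict_line (re_mpoly M C) a v"] by (auto simp: poly_restrict_line)
  qed
  have "ceval (re_mpoly M C) (($) z) \<noteq> 0" if "\<And>j. Im (z $ j) > 0" for z :: "complex^'n"
  proof -
    have "($) z = ?l (\<chi> i. Re (z $ i)) (\<chi> i. Im (z $ i)) \<i>"
      by (auto simp: fun_eq_iff complex_eq_iff)
    then show ?thesis using line[of "\<chi> i. Im (z $ i)" \<i> "\<chi> i. Re (z $ i)"] that by simp
  qed
  then show ?thesis using line by (auto simp: Hs_def real_stable_def)
qed

subsection \<open>Operators preserving strict real stability\<close>

text \<open>By joint continuity the functions for \<open>e n\<close> converge uniformly on compact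
  sets. By Hurwitz's theorem a limit of zero-free functions is zero-free or constant; having the
  zero \<open>s0\<close>, it is identically zero.\<close>

lemma hurwitz_param:
  fixes \<Phi> :: "complex \<Rightarrow> real \<Rightarrow> complex"
  assumes S: "open S" "connected S"
    and cont: "continuous_on UNIV (\<lambda>x. \<Phi> (fst x) (snd x))"
    and hol: "\<And>e. (\<lambda>s. \<Phi> s e) holomorphic_on S"
    and e: "e \<longlonglongrightarrow> 0"
    and nz: "\<And>n s. s \<in> S \<Longrightarrow> \<Phi> s (e n) \<noteq> 0"
    and s0: "s0 \<in> S" "\<Phi> s0 0 = 0" and s: "s \<in> S"
  shows "\<Phi> s 0 = 0"
proof (rule ccontr)
  assume ns: "\<Phi> s 0 \<noteq> 0"
  have "uniform_limit K (\<lambda>n s. \<Phi> s (e n)) (\<lambda>s. \<Phi> s 0) sequentially" if K: "compact K" for K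
  proof (rule uniform_limitI)
    fix r :: real assume r: "r > 0"
    have "compact (K \<times> cball (0::real) 1)" using K by (intro compact_Times compact_cball)
    then have "uniformly_continuous_on (K \<times> cball 0 1) (\<lambda>x. \<Phi> (fst x) (snd x))"
      using cont by (intro compact_uniformly_continuous) (auto intro: continuous_on_subset)
    then obtain d where d: "d > 0" "\<And>x y. x \<in> K \<times> cball 0 1 \<Longrightarrow> y \<in> K \<times> cball 0 1 \<Longrightarrow> dist y x < d \<Longrightarrow>
        dist (\<Phi> (fst y) (snd y)) (\<Phi> (fst x) (snd x)) < r"
      using r unfolding uniformly_continuous_on_def by metis
    have "eventually (\<lambda>n. dist (e n) 0 < min d 1) sequentially"
      using e d(1) by (intro tendstoD) auto
    then show "\<forall>\<^sub>F n in sequentially. \<forall>s\<in>K. dist (\<Phi> s (e n)) (\<Phi> s 0) < r"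
    proof eventually_elim
      case (elim n)
      show ?case
      proof
        fix s assume "s \<in> K"
        then show "dist (\<Phi> s (e n)) (\<Phi> s 0) < r"
          using elim d(2)[of "(s, 0)" "(s, e n)"] by (auto simp: dist_Pair_Pair dist_commute)
      qed
    qed
  qed
  moreover have "\<not> (\<lambda>s. \<Phi> s 0) constant_on S"
    using ns s s0 by (metis constant_on_def)
  ultimately have "\<Phi> s0 0 \<noteq> 0"
    using S hol nz s0(1) by (intro Hurwitz_no_zeros[of S "\<lambda>n s. \<Phi> s (e n)" "\<lambda>s. \<Phi> s 0"]) auto
  with s0 show False by simp
qed

text \<open>\<open>p\<close> and \<open>q\<close> stand for the images of the real and imaginary
  parts of a complex polynomial. Interior, real and arbitrary \<open>z\<close> are treated in
  turn.\<close>

lemma vanish_if_zeros_in_both_half_spaces: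
  fixes p q :: "('n::finite \<Rightarrow> complex) \<Rightarrow> complex"
  assumes lin: "\<And>a b :: real. (a, b) \<noteq> (0, 0) \<Longrightarrow>
      \<exists>S\<in>Hs \<union> {0}. \<forall>x. ceval S x = of_real a * p x + of_real b * q x"
    and z: "\<And>i. Im (z i) \<ge> 0" "p z + \<i> * q z = 0"
    and \<zeta>: "\<And>i. Im (\<zeta> i) < 0" "p \<zeta> + \<i> * q \<zeta> = 0"
  shows "p x = 0 \<and> q x = 0"
proof -
  have "(1 :: real, 0 :: real) \<noteq> (0, 0)" "(0 :: real, 1 :: real) \<noteq> (0, 0)" by simp_all
  from this[THEN lin] obtain P Q where
    "\<forall>x. ceval P x = of_real 1 * p x + of_real 0 * q x" "\<forall>x. ceval Q x = of_real 0 * p x + of_real 1 * q x"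
    by blast
  then have P: "\<And>x. ceval P x = p x" and Q: "\<And>x. ceval Q x = q x" by simp_all
  have cnj: "p (\<lambda>i. cnj (x i)) = cnj (p x)" "q (\<lambda>i. cnj (x i)) = cnj (q x)" for x
    using ceval_cnj[of P] ceval_cnj[of Q] by (simp_all add: P Q)
  \<comment> \<open>A real combination with a zero in the open upper half-space is not stable, so it
    is the zero polynomial.\<close>
  have all: "of_real a * p x + of_real b * q x = 0"
    if ab: "(a, b) \<noteq> (0, 0)" and y: "\<And>i. Im (y i) > 0" "of_real a * p y + of_real b * q y = 0" for a b :: real and y x
  proof -
    obtain S where S: "S \<in> Hs \<union> {0}" "\<And>x. ceval S x = of_real a * p x + of_real b * q x"
      using lin[OF ab] by blast
    have "ceval S (($) (\<chi> i. y i)) = 0" using S(2) y(2) by (simp add: vec_lambda_inverse)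
    then have "S \<notin> Hs" using y(1) unfolding Hs_def real_stable_def by force
    then show ?thesis using S by (metis UnE ceval_0 singletonD)
  qed
  define \<zeta>' where "\<zeta>' = (\<lambda>i. cnj (\<zeta> i))"
  have \<zeta>': "Im (\<zeta>' i) > 0" for i using \<zeta>(1) by (simp add: \<zeta>'_def)
  \<comment> \<open>Conjugation moves the zero \<open>\<zeta>\<close> to a point of the upper
    half-space with \<open>p = \<i> * q\<close>, whereas zeros of \<open>p + \<i> * q\<close> have
    \<open>p = - \<i> * q\<close>.\<close>
  have "cnj (p \<zeta> + \<i> * q \<zeta>) = 0" using \<zeta>(2) by simp
  then have p\<zeta>': "p \<zeta>' = \<i> * q \<zeta>'" by (simp add: \<zeta>'_def cnj)
  have both: "p x = 0 \<and> q x = 0" if "\<And>i. Im (y i) > 0" "p y = 0" "q y = 0" for x y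
    using all[of 1 0 y x] all[of 0 1 y x] that by simp
  have interior: "p x = 0 \<and> q x = 0" if y: "\<And>i. Im (y i) > 0" "p y + \<i> * q y = 0" for x y
  proof (rule ccontr)
    assume *: "\<not> ?thesis"
    have py: "p y = - \<i> * q y" using y(2) by (simp add: eq_neg_iff_add_eq_0)
    have "q y \<noteq> 0"
    proof
      assume "q y = 0"
      with py have "p y = 0" by simp
      from both[OF y(1) this \<open>q y = 0\<close>] * show False by blast
    qed
    have q0: "q w \<noteq> 0" if "\<And>i. Im (w i) > 0" for w
    proof
      assume "q w = 0"
      then have "of_real 0 * p w + of_real 1 * q w = 0" by simp
      from all[OF _ that this, of y] \<open>q y \<noteq> 0\<close> show False by simp
    qed
    \<comment> \<open>By convexity the segment from \<open>y\<close> to \<open>\<zeta>'\<close>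
      stays in the open upper half-space, where \<open>q\<close> has no zeros. Along it the
      imaginary part of \<open>p / q\<close> passes from -1 to 1.\<close>
    define \<gamma> where "\<gamma> s i = of_real (1 - s) * y i + of_real s * \<zeta>' i" for s :: real and i
    have \<gamma>: "Im (\<gamma> s i) > 0" if "0 \<le> s" "s \<le> 1" for s i
    proof -
      have "(1 - s) * Im (y i) + s * Im (\<zeta>' i) > 0"
      proof (cases "s = 0")
        case False
        then show ?thesis using that y(1)[of i] \<zeta>'[of i]
          by (intro add_nonneg_pos mult_nonneg_nonneg mult_pos_pos) auto
      qed (use y(1) in simp)
      then show ?thesis by (simp add: \<gamma>_def)
    qed
    have "continuous_on {0..1} (\<lambda>s. Im (p (\<gamma> s) / q (\<gamma> s)))"
      unfolding P[symmetric] Q[symmetric] using \<gamma> q0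
      by (intro continuous_intros) (auto simp: \<gamma>_def Q intro!: continuous_intros)
    moreover have "\<gamma> 0 = y" "\<gamma> 1 = \<zeta>'" by (auto simp: \<gamma>_def)
    then have "Im (p (\<gamma> 0) / q (\<gamma> 0)) = -1" "Im (p (\<gamma> 1) / q (\<gamma> 1)) = 1"
      using py p\<zeta>' \<open>q y \<noteq> 0\<close> q0[of \<zeta>'] \<zeta>' by auto
    ultimately obtain s where s: "0 \<le> s" "s \<le> 1" "Im (p (\<gamma> s) / q (\<gamma> s)) = 0"
      using IVT'[of "\<lambda>s. Im (p (\<gamma> s) / q (\<gamma> s))" 0 0 1] by auto
    \<comment> \<open>A real value \<open>c\<close> makes \<open>p - c * q\<close> vanish at an
      interior point, hence everywhere, although \<open>p y / q y = - \<i>\<close>.\<close>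
    define c where "c = Re (p (\<gamma> s) / q (\<gamma> s))"
    have "p (\<gamma> s) / q (\<gamma> s) = of_real c" using s(3) by (simp add: c_def complex_eq_iff)
    then have "p (\<gamma> s) = of_real c * q (\<gamma> s)" using q0 \<gamma> s by (simp add: divide_eq_eq)
    then have "p y = of_real c * q y"
      using all[of 1 "-c" "\<gamma> s" y] \<gamma>[OF s(1,2)] by simp
    with py have "of_real c * q y = - \<i> * q y" by simp
    then have "of_real c = - \<i>" using \<open>q y \<noteq> 0\<close> by (metis mult_cancel_right)
    then show False by (simp add: complex_eq_iff)
  qed
  have real: "p x = 0 \<and> q x = 0" if \<alpha>: "p (\<lambda>i. of_real (\<alpha> i)) = 0" "q (\<lambda>i. of_real (\<alpha> i)) = 0"
    for x and \<alpha> :: "'n \<Rightarrow> real"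
  proof -
    let ?r = "\<lambda>f. restrict_line f (\<chi> i. \<alpha> i) (\<chi> i. 1)"
    define p' q' where "p' = poly (pderiv (?r P)) 0" and "q' = poly (pderiv (?r Q)) 0"
    have line: "poly (map_poly of_real (?r f)) t = ceval f (\<lambda>i. of_real (\<alpha> i) + t)" for f t
      by (simp add: poly_restrict_line)
    \<comment> \<open>A nontrivial real combination whose derivative along the diagonal line also
      vanishes at \<open>\<alpha>\<close>: a multiple zero, which \<open>H1s\<close>
      forbids.\<close>
    obtain a b where ab: "(a, b) \<noteq> (0, 0)" "a * p' + b * q' = 0"
    proof (cases "p' = 0")
      case True
      then show ?thesis using that[of 1 0] by simp
    next
      case False
      then show ?thesis using that[of q' "- p'"] by simp
    qed
    obtain S where S: "S \<in> Hs \<union> {0}" "\<And>x. ceval S x = of_real a * p x + of_real b * q x"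
      using lin[OF ab(1)] by blast
    have "poly (?r S) t = poly (smult a (?r P) + smult b (?r Q)) t" for t
    proof -
      have "complex_of_real (poly (?r S) t) = of_real (poly (smult a (?r P) + smult b (?r Q)) t)"
        using line[of S "of_real t"] line[of P "of_real t"] line[of Q "of_real t"]
        by (simp add: poly_of_real S(2) P Q)
      then show ?thesis by (simp only: of_real_eq_iff)
    qed
    then have r: "?r S = smult a (?r P) + smult b (?r Q)" by (simp add: poly_eq_poly_eq_iff[symmetric] fun_eq_iff)
    have "?r S \<notin> H1s"
    proof
      assume H: "?r S \<in> H1s"
      let ?m = "map_poly complex_of_real (?r S)"
      have 0: "poly ?m 0 = 0" using \<alpha> by (simp add: line S(2))
      then have o: "order 0 ?m = 1" and "?m \<noteq> 0"
        using H unfolding H1s_def by (blast, simp add: map_poly_eq_0_iff)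
      have "pderiv ?m = map_poly of_real (pderiv (?r S))"
        by (rule poly_eqI) (simp add: coeff_pderiv coeff_map_poly)
      then have "poly (pderiv ?m) 0 = of_real (a * p' + b * q')"
        using poly_of_real[of "pderiv (?r S)" 0] by (simp add: r pderiv_add pderiv_smult p'_def q'_def)
      then have "poly (pderiv ?m) 0 = 0" using ab by simp
      moreover have "pderiv ?m \<noteq> 0"
      proof
        assume "pderiv ?m = 0"
        then obtain h where "?m = [:h:]" using pderiv_iszero by blast
        with 0 \<open>?m \<noteq> 0\<close> show False by simp
      qed
      ultimately show False
        using order_pderiv[of ?m 0] o \<open>?m \<noteq> 0\<close> by (simp add: order_root)
    qed
    then have "S = 0" using S(1) by (auto simp: Hs_def)
    \<comment> \<open>With \<open>p \<zeta>' = \<i> * q \<zeta>'\<close>, the zero combination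
      forces \<open>q \<zeta>' = 0\<close>, so that \<open>p\<close> and \<open>q\<close> share an
      interior zero.\<close>
    then have ab0: "of_real a * p \<zeta>' + of_real b * q \<zeta>' = 0" using S(2)[of \<zeta>'] by simp
    then have "(of_real a * \<i> + of_real b) * q \<zeta>' = 0" by (simp add: p\<zeta>' algebra_simps)
    moreover have "of_real a * \<i> + of_real b \<noteq> 0" using ab(1) by (auto simp: complex_eq_iff)
    ultimately have "q \<zeta>' = 0" by simp
    then show ?thesis using both[of \<zeta>'] \<zeta>' p\<zeta>' by simp
  qed
  show ?thesis
  proof (rule ccontr)
    assume *: "\<not> ?thesis"
    \<comment> \<open>At \<open>e = 0\<close> this complex line passes through \<open>Re z\<close>
      for \<open>s = 0\<close> and \<open>z\<close> for \<open>s = \<i>\<close>. For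
      \<open>e > 0\<close> and \<open>Im s > 0\<close> it lies in the open upper half-space, where
      \<open>interior\<close> excludes zeros.\<close>
    define \<Phi> where "\<Phi> s e = (let w = (\<lambda>i. of_real (Re (z i)) + s * of_real (Im (z i)) + \<i> * of_real e)
      in ceval P w + \<i> * ceval Q w)" for s :: complex and e :: real
    have lim: "(\<lambda>n. 1 / real (Suc n)) \<longlonglongrightarrow> 0"
      using LIMSEQ_inverse_real_of_nat by (simp add: inverse_eq_divide)
    have \<Phi>0: "\<Phi> s 0 = 0" if "Im s > 0" for s
    proof (rule hurwitz_param[where \<Phi> = \<Phi> and s = s and ?s0.0 = \<i> and e = "\<lambda>n. 1 / real (Suc n)" and S = "{s. Im s > 0}"])
      show "open {s. Im s > 0}" "connected {s. Im s > 0}"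
        by (auto simp: open_halfspace_Im_gt convex_halfspace_Im_gt convex_connected)
      show "(\<lambda>n. 1 / real (Suc n)) \<longlonglongrightarrow> 0" by (rule lim)
      show "continuous_on UNIV (\<lambda>x. \<Phi> (fst x) (snd x))"
        unfolding \<Phi>_def Let_def by (intro continuous_intros)
      show "(\<lambda>s. \<Phi> s e) holomorphic_on {s. Im s > 0}" for e
        unfolding \<Phi>_def Let_def by (intro holomorphic_intros)
      show "\<Phi> s (1 / real (Suc n)) \<noteq> 0" if "s \<in> {s. Im s > 0}" for s n
      proof
        assume 0: "\<Phi> s (1 / real (Suc n)) = 0"
        define w where "w = (\<lambda>i. of_real (Re (z i)) + s * of_real (Im (z i)) + \<i> * complex_of_real (1 / real (Suc n)))"
        have "Im (w i) = Im s * Im (z i) + 1 / real (Suc n)" for i by (simp add: w_def)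
        moreover have "Im s * Im (z i) + 1 / real (Suc n) > 0" for i
          using that z(1)[of i] by (intro add_nonneg_pos mult_nonneg_nonneg) auto
        ultimately have "Im (w i) > 0" for i by metis
        moreover have "p w + \<i> * q w = 0" using 0 by (simp only: \<Phi>_def Let_def P Q w_def)
        ultimately show False using interior[of w x] * by blast
      qed
      have "(\<lambda>i. of_real (Re (z i)) + \<i> * of_real (Im (z i))) = z" by (simp add: complex_eq[symmetric])
      then show "\<Phi> \<i> 0 = 0" using z(2) by (simp add: \<Phi>_def P Q)
    qed (use that in auto)
    have "(\<lambda>n. \<Phi> (\<i> * of_real (1 / real (Suc n))) 0) \<longlonglongrightarrow> \<Phi> (\<i> * of_real 0) 0"
    proof (rule continuous_on_tendsto_compose[where s = UNIV and f = "\<lambda>s. \<Phi> s 0"])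
      show "continuous_on UNIV (\<lambda>s. \<Phi> s 0)"
        unfolding \<Phi>_def Let_def by (intro continuous_intros)
      show "(\<lambda>n. \<i> * complex_of_real (1 / real (Suc n))) \<longlonglongrightarrow> \<i> * of_real 0"
        by (rule tendsto_mult_left[OF tendsto_of_real[OF lim]])
    qed auto
    moreover have "\<Phi> (\<i> * of_real (1 / real (Suc n))) 0 = 0" for n by (rule \<Phi>0) simp
    ultimately have 0: "\<Phi> 0 0 = 0" by (simp only: LIMSEQ_const_iff of_real_0 mult_zero_right)
    let ?\<alpha> = "\<lambda>i. complex_of_real (Re (z i))"
    have pq: "p ?\<alpha> + \<i> * q ?\<alpha> = 0" using 0 by (simp add: \<Phi>_def P Q Let_def)
    \<comment> \<open>At a real point \<open>p\<close> and \<open>q\<close> are real, so both vanish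
      there.\<close>
    moreover have "Im (p ?\<alpha>) = 0" "Im (q ?\<alpha>) = 0" using cnj[of ?\<alpha>] by (simp_all add: complex_eq_iff)
    ultimately have "p ?\<alpha> = 0" "q ?\<alpha> = 0" by (simp_all add: complex_eq_iff)
    from real[OF this, of x] * show False by blast
  qed
qed

text \<open>The assumptions on \<open>h\<close> survive multiplication by a nonzero constant, and
  every real combination of its real and imaginary parts is the real part of such a
  multiple.\<close>

lemma weyl_op_vanish:
  fixes C :: "'n::finite mexp \<Rightarrow> complex"
  assumes T: "\<And>f. f \<in> Hs \<Longrightarrow> weyl_op c f \<in> Hs \<union> {0}"
    and h: "h = (\<lambda>x. \<Sum>m\<in>M. C m * mpower x m)"
    and nz: "\<And>x. (\<And>i. Im (x i) \<ge> 0) \<Longrightarrow> h x \<noteq> 0"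
    and lz: "\<And>a v :: real^'n. (\<And>i. v $ i > 0) \<Longrightarrow> \<exists>t. h (\<lambda>i. of_real (a $ i) + of_real (v $ i) * t) = 0"
    and z: "\<And>i. Im (z i) \<ge> 0" "(\<Sum>m\<in>M. C m * weyl_mono c m z) = 0"
    and \<zeta>: "\<And>i. Im (\<zeta> i) < 0" "(\<Sum>m\<in>M. C m * weyl_mono c m \<zeta>) = 0"
  shows "(\<Sum>m\<in>M. C m * weyl_mono c m x) = 0"
proof -
  define p where "p x = (\<Sum>m\<in>M. of_real (Re (C m)) * weyl_mono c m x)" for x
  define q where "q x = (\<Sum>m\<in>M. of_real (Im (C m)) * weyl_mono c m x)" for x
  have pq: "p x + \<i> * q x = (\<Sum>m\<in>M. C m * weyl_mono c m x)" for x
  proof -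
    have "p x + \<i> * q x = (\<Sum>m\<in>M. (of_real (Re (C m)) + \<i> * of_real (Im (C m))) * weyl_mono c m x)"
      by (simp add: p_def q_def sum_distrib_left sum.distrib[symmetric] distrib_right mult.assoc)
    then show ?thesis by (simp only: complex_eq[symmetric])
  qed
  have "p x = 0 \<and> q x = 0"
  proof (rule vanish_if_zeros_in_both_half_spaces[where p = p and q = q and z = z and \<zeta> = \<zeta>])
    fix a b :: real assume ab: "(a, b) \<noteq> (0, 0)"
    \<comment> \<open>Chosen so that \<open>Re (\<kappa> * u) = a * Re u + b * Im u\<close>.\<close>
    define \<kappa> where "\<kappa> = Complex a (- b)"
    have \<kappa>: "\<kappa> \<noteq> 0" using ab by (auto simp: \<kappa>_def complex_eq_iff)
    have "re_mpoly M (\<lambda>m. \<kappa> * C m) \<in> Hs"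
    proof (rule re_mpoly_in_Hs[where h = "\<lambda>x. \<kappa> * h x"])
      show "(\<lambda>x. \<kappa> * h x) = (\<lambda>x. \<Sum>m\<in>M. \<kappa> * C m * mpower x m)"
        by (simp add: h sum_distrib_left mult.assoc)
    qed (use \<kappa> nz lz in auto)
    then have "weyl_op c (re_mpoly M (\<lambda>m. \<kappa> * C m)) \<in> Hs \<union> {0}" by (rule T)
    moreover have "ceval (weyl_op c (re_mpoly M (\<lambda>m. \<kappa> * C m))) x = of_real a * p x + of_real b * q x" for x
    proof -
      have "complex_of_real (Re (\<kappa> * C m)) = of_real a * of_real (Re (C m)) + of_real b * of_real (Im (C m))" for m
        by (simp add: \<kappa>_def)
      then show ?thesis
        by (simp only: ceval_weyl_op_re_mpoly distrib_right sum.distrib p_def q_def sum_distrib_left mult.assoc)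
    qed
    ultimately show "\<exists>S\<in>Hs \<union> {0}. \<forall>x. ceval S x = of_real a * p x + of_real b * q x" by blast
  qed (use z \<zeta> pq in auto)
  with pq[of x] show ?thesis by simp
qed

subsection \<open>Powers of linear factors\<close>

text \<open>Since \<open>cmod (t - \<zeta>)\<close> is at least \<open>- Im \<zeta>\<close>, the
  term \<open>cmod (\<zeta> - a)\<close> of the triangle inequality is at most a multiple of
  it.\<close>

lemma linear_factor_bound:
  assumes "Im \<zeta> < 0"
  obtains B :: real where "B > 0" "\<And>t. Im t \<ge> 0 \<Longrightarrow> cmod (t - a) \<le> B * cmod (t - \<zeta>)"
proof
  let ?B = "1 + cmod (\<zeta> - a) / - Im \<zeta>"
  show "?B > 0" using assms by (intro add_pos_nonneg divide_nonneg_pos) auto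
  fix t assume t: "Im t \<ge> 0"
  have "- Im \<zeta> \<le> cmod (t - \<zeta>)" using t abs_Im_le_cmod[of "t - \<zeta>"] by simp
  then have "cmod (\<zeta> - a) / - Im \<zeta> * - Im \<zeta> \<le> cmod (\<zeta> - a) / - Im \<zeta> * cmod (t - \<zeta>)"
    using assms by (intro mult_left_mono divide_nonneg_pos) auto
  then have "cmod (\<zeta> - a) \<le> cmod (\<zeta> - a) / - Im \<zeta> * cmod (t - \<zeta>)" using assms by simp
  moreover have "cmod (t - a) \<le> cmod (t - \<zeta>) + cmod (\<zeta> - a)"
    using norm_triangle_ineq[of "t - \<zeta>" "\<zeta> - a"] by simp
  ultimately show "cmod (t - a) \<le> ?B * cmod (t - \<zeta>)"
    unfolding distrib_right mult_1 by linarith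
qed

lemma power_dvd_pderiv:
  fixes p :: "complex poly"
  assumes "[:- a, 1:] ^ Suc k dvd p"
  shows "[:- a, 1:] ^ k dvd pderiv p"
proof -
  obtain g where g: "p = [:- a, 1:] ^ Suc k * g" using assms by (rule dvdE)
  have "pderiv p = [:- a, 1:] ^ k * ([:- a, 1:] * pderiv g + smult (of_nat (Suc k)) g)"
    unfolding g pderiv_mult pderiv_power_Suc by (simp add: pderiv_pCons algebra_simps)
  then show ?thesis by simp
qed

lemma poly_higher_pderiv_eq_0:
  fixes p :: "complex poly"
  assumes "[:- a, 1:] ^ k dvd p" "b < k"
  shows "poly ((pderiv ^^ b) p) a = 0"
proof -
  have "[:- a, 1:] ^ (k - b) dvd (pderiv ^^ b) p" if "b \<le> k" for b
    using that
  proof (induction b)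
    case (Suc b)
    then have "[:- a, 1:] ^ Suc (k - Suc b) dvd (pderiv ^^ b) p" by (simp add: Suc_diff_Suc)
    then show ?case using power_dvd_pderiv by simp
  qed (use assms in simp)
  then have "[:- a, 1:] ^ (k - b) dvd (pderiv ^^ b) p" using assms by simp
  moreover have "[:- a, 1:] dvd [:- a, 1:] ^ (k - b)" using assms by (intro dvd_power) simp
  ultimately show ?thesis using dvd_trans poly_eq_0_iff_dvd by blast
qed

lemma poly_higher_pderiv_power_mult:
  "poly ((pderiv ^^ b) ([:- a, 1:] ^ b * g)) a = fact b * poly g a" for g :: "complex poly"
proof (induction b arbitrary: g)
  case (Suc b)
  have "pderiv ([:- a, 1:] ^ Suc b * g) = [:- a, 1:] ^ b * ([:- a, 1:] * pderiv g + smult (of_nat (Suc b)) g)"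
    unfolding pderiv_mult pderiv_power_Suc by (simp add: pderiv_pCons algebra_simps)
  then show ?case
    by (simp only: funpow_Suc_right o_apply Suc.IH) (simp add: algebra_simps)
qed simp

lemma higher_pderiv_linear_power:
  "(pderiv ^^ b) ([:- a, 1:] ^ N) = smult (of_nat (\<Prod>l<b. N - l)) ([:- a, 1:] ^ (N - b))"
  for a :: complex
proof (induction b)
  case (Suc b)
  show ?case
  proof (cases "N - b")
    case 0
    then show ?thesis using Suc by (simp add: pderiv_smult)
  next
    case (Suc k)
    then have k: "N - Suc b = k" by simp
    have "pderiv [:- a, 1:] = 1" by (simp add: pderiv_pCons)
    then have "(pderiv ^^ Suc b) ([:- a, 1:] ^ N) =
        smult (of_nat (\<Prod>l<b. N - l)) (smult (of_nat (Suc k)) ([:- a, 1:] ^ k))"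
      by (simp only: funpow.simps o_apply Suc.IH Suc pderiv_smult pderiv_power_Suc mult_1_right)
    then show ?thesis
      by (simp only: smult_smult of_nat_mult[symmetric] prod.lessThan_Suc k Suc)
  qed
qed simp

text \<open>The choice of \<open>a\<close> gives \<open>(x - a) * (- w / N) = 1\<close>, so each
  factor \<open>x - a\<close> lost by differentiation amounts to a factor \<open>- w / N\<close>.
  The powers of \<open>N\<close> cancel against the falling factorial, leaving
  \<open>1 - l / N\<close>.\<close>

lemma poly_higher_pderiv_linear_power:
  fixes a x w :: complex
  assumes "b \<le> N" "0 < N" "w \<noteq> 0" "a = x + of_nat N / w"
  shows "poly ((pderiv ^^ b) ([:- a, 1:] ^ N)) x =
    (x - a) ^ N * ((\<Prod>l<b. of_real (1 - real l * (1 / real N))) * (- w) ^ b)"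
proof -
  have xa: "(x - a) * (- w / of_nat N) = 1" using assms by (simp add: field_simps)
  have "(x - a) ^ N * (- w / of_nat N) ^ b = (x - a) ^ (N - b) * ((x - a) * (- w / of_nat N)) ^ b"
    using assms(1) by (simp only: power_mult_distrib power_add[symmetric] mult.assoc[symmetric] le_add_diff_inverse2)
  then have *: "(x - a) ^ (N - b) = (x - a) ^ N * (- w / of_nat N) ^ b" by (simp only: xa power_one mult_1_right)
  have "complex_of_nat (\<Prod>l<b. N - l) = (\<Prod>l<b. of_nat N * of_real (1 - real l * (1 / real N)))"
    unfolding of_nat_prod
  proof (rule prod.cong)
    fix l assume "l \<in> {..<b}"
    then have "l \<le> N" using assms(1) by simp
    then show "complex_of_nat (N - l) = of_nat N * of_real (1 - real l * (1 / real N))"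
      using assms(2) by (simp add: of_nat_diff field_simps)
  qed simp
  also have "\<dots> = of_nat N ^ b * (\<Prod>l<b. of_real (1 - real l * (1 / real N)))"
    by (simp only: prod.distrib prod_constant card_lessThan)
  finally have "poly ((pderiv ^^ b) ([:- a, 1:] ^ N)) x =
      of_nat N ^ b * (\<Prod>l<b. of_real (1 - real l * (1 / real N))) * ((x - a) ^ N * (- w / of_nat N) ^ b)"
    by (simp add: higher_pderiv_linear_power poly_power * del: of_nat_prod of_real_diff of_real_1 of_real_mult)
  also have "\<dots> = (x - a) ^ N * ((\<Prod>l<b. of_real (1 - real l * (1 / real N))) * (of_nat N ^ b * (- w / of_nat N) ^ b))"
    by (simp only: mult_ac)
  also have "of_nat N ^ b * (- w / of_nat N) ^ b = (- w) ^ b"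
    using assms(2) by (simp add: power_mult_distrib[symmetric])
  finally show ?thesis .
qed

subsection \<open>Zeros of the symbol\<close>

text \<open>A polynomial vanishing on a product of infinite sets has zero coefficients; the
  \<open>b\<close> with the same exponents contribute to one coefficient. The induction reads the
  sum as a polynomial in one further variable.\<close>

lemma sum_prod_power_eq_0:
  fixes e :: "'b \<Rightarrow> 'n \<Rightarrow> nat" and c :: "'b \<Rightarrow> complex"
  assumes "finite J" "finite B" "\<And>i. infinite (A i)"
    and "\<And>y. (\<And>i. y i \<in> A i) \<Longrightarrow> (\<Sum>b\<in>B. c b * (\<Prod>i\<in>J. y i ^ e b i)) = 0"
  shows "(\<Sum>b\<in>{b\<in>B. \<forall>i\<in>J. e b i = k i}. c b) = 0"
  using assms(1,2,4)
proof (induction J arbitrary: B rule: finite_induct)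
  case empty
  have "\<exists>y. \<forall>i. y i \<in> A i" using infinite_imp_nonempty[OF assms(3)] by (intro choice) blast
  with empty show ?case by auto
next
  case (insert j J)
  have "(\<Sum>b\<in>{b\<in>B. e b j = k j}. c b * (\<Prod>i\<in>J. y i ^ e b i)) = 0" if y: "\<And>i. y i \<in> A i" for y
  proof -
    define p where "p = (\<Sum>b\<in>B. monom (c b * (\<Prod>i\<in>J. y i ^ e b i)) (e b j))"
    have "poly p t = 0" if "t \<in> A j" for t
    proof -
      have "(\<Sum>b\<in>B. c b * (\<Prod>i\<in>insert j J. (y(j := t)) i ^ e b i)) = 0"
        using y that by (intro insert.prems) auto
      moreover have "(\<Prod>i\<in>insert j J. (y(j := t)) i ^ e b i) = t ^ e b j * (\<Prod>i\<in>J. y i ^ e b i)" for b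
      proof -
        have "(\<Prod>i\<in>J. (y(j := t)) i ^ e b i) = (\<Prod>i\<in>J. y i ^ e b i)"
          using insert.hyps(2) by (intro prod.cong) (auto split: if_splits)
        then show ?thesis using insert.hyps by simp
      qed
      ultimately show ?thesis by (simp add: p_def poly_sum poly_monom mult_ac)
    qed
    then have "A j \<subseteq> {t. poly p t = 0}" by auto
    then have "p = 0" using assms(3)[of j] poly_roots_finite[of p] finite_subset by blast
    then have "coeff p (k j) = 0" by simp
    then show ?thesis
      using insert.prems(1) by (simp add: p_def coeff_sum sum.inter_filter if_distrib cong: if_cong)
  qed
  then have "(\<Sum>b\<in>{b\<in>{b\<in>B. e b j = k j}. \<forall>i\<in>J. e b i = k i}. c b) = 0"
    using insert.prems(1) by (intro insert.IH) auto
  also have "{b\<in>{b\<in>B. e b j = k j}. \<forall>i\<in>J. e b i = k i} = {b\<in>B. \<forall>i\<in>insert j J. e b i = k i}" by auto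
  finally show ?case .
qed

text \<open>For \<open>e = 1 / N\<close> this is, up to a nonzero factor, the value at \<open>z\<close> of the operator applied to
  \<open>\<Prod>\<^sub>i (1 - (x\<^sub>i - z\<^sub>i) w\<^sub>i / N) ^ N\<close>, where \<open>y = - w\<close>; for \<open>e = 0\<close> it is the symbol.\<close>

definition deformed_symbol ::
    "('n mexp \<times> 'n mexp \<Rightarrow>\<^sub>0 real) \<Rightarrow> real \<Rightarrow> ('n::finite \<Rightarrow> complex) \<Rightarrow> ('n \<Rightarrow> complex) \<Rightarrow> complex" where
  "deformed_symbol c e z y = (\<Sum>p\<in>Poly_Mapping.keys c. of_real (Poly_Mapping.lookup c p) * mpower z (fst p) *
     (\<Prod>i\<in>UNIV. (\<Prod>l<Poly_Mapping.lookup (snd p) i. of_real (1 - real l * e)) * y i ^ Poly_Mapping.lookup (snd p) i))"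

lemma deformed_symbol_0:
  "deformed_symbol c 0 z y = (\<Sum>p\<in>Poly_Mapping.keys c. of_real (Poly_Mapping.lookup c p) * mpower z (fst p) * mpower y (snd p))"
  by (simp add: deformed_symbol_def mpower_def)

text \<open>For the given \<open>z\<close>, the coefficient of every power of \<open>y\<close> in
  the symbol is zero, and the deformation only multiplies these coefficients by numbers.\<close>

lemma deformed_symbol_eq_0:
  assumes "\<And>w. (\<And>i. Im (w i) > 0) \<Longrightarrow> deformed_symbol c 0 z (\<lambda>i. - w i) = 0"
  shows "deformed_symbol c e z y = 0"
proof -
  let ?K = "Poly_Mapping.keys c"
  define a where "a p = of_real (Poly_Mapping.lookup c p) * mpower z (fst p)" for p
  have sum0: "(\<Sum>p\<in>{p\<in>?K. snd p = b}. a p) = 0" for b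
  proof -
    have "(\<Sum>p\<in>{p\<in>?K. \<forall>i\<in>UNIV. Poly_Mapping.lookup (snd p) i = Poly_Mapping.lookup b i}. a p) = 0"
    proof (rule sum_prod_power_eq_0[where A = "\<lambda>_. {u. Im u < 0}"])
      have "open {u. Im u < 0}" "- \<i> \<in> {u. Im u < 0}" by (auto simp: open_halfspace_Im_lt)
      then show "infinite {u. Im u < 0}" using finite_imp_not_open by blast
      fix y :: "'a \<Rightarrow> complex" assume "\<And>i. y i \<in> {u. Im u < 0}"
      then show "(\<Sum>p\<in>?K. a p * (\<Prod>i\<in>UNIV. y i ^ Poly_Mapping.lookup (snd p) i)) = 0"
        using assms[of "\<lambda>i. - y i"] by (simp add: deformed_symbol_0 a_def mpower_def)
    qed simp_all
    also have "{p\<in>?K. \<forall>i\<in>UNIV. Poly_Mapping.lookup (snd p) i = Poly_Mapping.lookup b i} = {p\<in>?K. snd p = b}"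
      by (auto intro: poly_mapping_eqI)
    finally show ?thesis .
  qed
  define g where "g b = (\<Prod>i\<in>UNIV. (\<Prod>l<Poly_Mapping.lookup b i. of_real (1 - real l * e)) * y i ^ Poly_Mapping.lookup b i)" for b
  have "deformed_symbol c e z y = (\<Sum>p\<in>?K. a p * g (snd p))"
    by (simp only: deformed_symbol_def a_def g_def)
  also have "\<dots> = (\<Sum>b\<in>snd ` ?K. \<Sum>p\<in>{p\<in>?K. snd p = b}. a p * g (snd p))"
    by (rule sum.image_gen) simp
  also have "\<dots> = (\<Sum>b\<in>snd ` ?K. (\<Sum>p\<in>{p\<in>?K. snd p = b}. a p) * g b)"
    by (simp add: sum_distrib_right)
  finally show ?thesis by (simp add: sum0)
qed

text \<open>The coefficient of the \<open>\<beta>\<close>-th derivative is a nonzero polynomial, so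
  it cannot vanish on the product of the complements of the \<open>X i\<close>.\<close>

lemma exists_coefficient_nonzero:
  assumes "(\<alpha>, \<beta>) \<in> Poly_Mapping.keys c" "\<And>i. finite (X i)"
  obtains x :: "'n::finite \<Rightarrow> complex" where "\<And>i. x i \<notin> X i"
    "(\<Sum>p\<in>{p\<in>Poly_Mapping.keys c. snd p = \<beta>}. of_real (Poly_Mapping.lookup c p) * mpower x (fst p)) \<noteq> 0"
proof -
  let ?B = "{p\<in>Poly_Mapping.keys c. snd p = \<beta>}"
  have "\<exists>x. (\<forall>i. x i \<notin> X i) \<and> (\<Sum>p\<in>?B. of_real (Poly_Mapping.lookup c p) * mpower x (fst p)) \<noteq> (0::complex)"
  proof (rule ccontr)
    assume *: "\<not> ?thesis"
    have "(\<Sum>p\<in>{p\<in>?B. \<forall>i\<in>UNIV. Poly_Mapping.lookup (fst p) i = Poly_Mapping.lookup \<alpha> i}.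
        complex_of_real (Poly_Mapping.lookup c p)) = 0"
    proof (rule sum_prod_power_eq_0[where A = "\<lambda>i. UNIV - X i"])
      show "infinite (UNIV - X i)" for i
        using assms(2) infinite_UNIV_char_0 by (intro Diff_infinite_finite) auto
      show "(\<Sum>p\<in>?B. of_real (Poly_Mapping.lookup c p) * (\<Prod>i\<in>UNIV. y i ^ Poly_Mapping.lookup (fst p) i)) = (0::complex)"
        if "\<And>i. y i \<in> UNIV - X i" for y
        using * that by (auto simp: mpower_def)
    qed simp_all
    also have "{p\<in>?B. \<forall>i\<in>UNIV. Poly_Mapping.lookup (fst p) i = Poly_Mapping.lookup \<alpha> i} = {(\<alpha>, \<beta>)}"
      using assms(1) by (auto intro: poly_mapping_eqI)
    finally show False using assms(1) by (simp add: in_keys_iff)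
  qed
  then show ?thesis using that by blast
qed

text \<open>The threshold \<open>N\<^sub>0\<close> makes the zeros \<open>z\<^sub>i + N / u\<close> of the linear factors lie below the real axis, uniformly in \<open>u \<in> V\<close>.\<close>

lemma exists_common_threshold:
  fixes z w0 w1 :: "'n::finite \<Rightarrow> complex"
  assumes "\<And>i. Im (w0 i) > 0" "\<And>i. Im (w1 i) > 0"
  obtains V :: "complex set" and N0 :: nat where "open V" "convex V" "\<And>i. w0 i \<in> V" "\<And>i. w1 i \<in> V"
    "\<And>u. u \<in> V \<Longrightarrow> Im u > 0" "\<And>N u i. N \<ge> N0 \<Longrightarrow> u \<in> V \<Longrightarrow> Im (z i + of_nat N / u) < 0"
proof -
  let ?W = "range w0 \<union> range w1"
  define \<eta> where "\<eta> = Min (Im ` ?W) / 2"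
  have min: "Min (Im ` ?W) > 0" using assms by (subst Min_gr_iff) auto
  have W: "Im u \<ge> 2 * \<eta>" "\<eta> > 0" if "u \<in> ?W" for u
    using that min by (auto simp: \<eta>_def)
  obtain B where B: "B > 0" "\<And>u. u \<in> ?W \<Longrightarrow> cmod u < B"
    using bounded_pos_less[of ?W] finite_imp_bounded[of ?W] by auto
  define Y where "Y = Max (range (\<lambda>i. Im (z i)))"
  have Y: "Im (z i) \<le> Y" for i by (simp add: Y_def)
  have \<eta>: "\<eta> > 0" using W by blast
  \<comment> \<open>Adding \<open>N / u\<close> lowers the imaginary part by
    \<open>N * Im u / (cmod u)\<^sup>2\<close>, which exceeds \<open>Y\<close> for
    \<open>N \<ge> N0\<close>, because \<open>Im u > \<eta>\<close> and
    \<open>cmod u < B\<close>.\<close>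
  obtain N0 :: nat where N0: "real N0 > \<bar>Y\<bar> * B\<^sup>2 / \<eta>" using reals_Archimedean2 by blast
  let ?V = "{u. Im u > \<eta>} \<inter> ball 0 B"
  show ?thesis
  proof (rule that[of ?V N0])
    show "open ?V" by (intro open_Int open_halfspace_Im_gt open_ball)
    show "convex ?V" by (intro convex_Int convex_halfspace_Im_gt convex_ball)
    show "w0 i \<in> ?V" "w1 i \<in> ?V" for i
      using W[of "w0 i"] W[of "w1 i"] B by (auto simp: dist_norm)
    show "Im u > 0" if "u \<in> ?V" for u using that \<eta> by auto
    show "Im (z i + of_nat N / u) < 0" if N: "N \<ge> N0" and u: "u \<in> ?V" for N u i
    proof -
      have u': "Im u > \<eta>" "cmod u < B" "cmod u > 0" using u \<eta> by (auto simp: dist_norm)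
      have "Y * (cmod u)\<^sup>2 \<le> \<bar>Y\<bar> * B\<^sup>2"
        using u' by (intro mult_mono power_mono) auto
      also have "\<dots> < real N0 * \<eta>" using N0 \<eta> by (simp add: pos_divide_less_eq)
      also have "\<dots> \<le> real N * Im u" using N u' \<eta> by (intro mult_mono) auto
      finally have "Y < real N * Im u / (cmod u)\<^sup>2" using u' by (simp add: pos_less_divide_eq)
      moreover have "Im (of_nat N / u) = - (real N * Im u / (cmod u)\<^sup>2)"
        by (simp add: Im_divide cmod_power2)
      ultimately show ?thesis using Y[of i] by simp
    qed
  qed
qed

text \<open>If the symbol is zero for all \<open>w\<close> in the upper half-space, so is every
  deformation. Otherwise Hurwitz's theorem is applied on the complex line from \<open>w0\<close> to
  some \<open>w1\<close> with nonzero symbol.\<close>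

lemma deformed_symbol_zero:
  assumes w0: "\<And>i. Im (w0 i) > 0" and 0: "deformed_symbol c 0 z (\<lambda>i. - w0 i) = 0"
  obtains N w where "N \<ge> N1" "N > 0" "\<And>i. Im (w i) > 0" "\<And>i. Im (z i + of_nat N / w i) < 0"
    "deformed_symbol c (1 / real N) z (\<lambda>i. - w i) = 0"
proof (cases "\<forall>w. (\<forall>i. Im (w i) > 0) \<longrightarrow> deformed_symbol c 0 z (\<lambda>i. - w i) = 0")
  case True
  obtain V N0 where V: "\<And>i. w0 i \<in> V" "\<And>N u i. N \<ge> N0 \<Longrightarrow> u \<in> V \<Longrightarrow> Im (z i + of_nat N / u) < 0"
    using exists_common_threshold[of w0 w0 z] w0 by metis
  show ?thesis
    using that[of "Suc (max N0 N1)" w0] w0 V(2)[OF _ V(1)] deformed_symbol_eq_0[of c z] True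
    by (simp del: of_nat_Suc)
next
  case False
  then obtain w1 where w1: "\<And>i. Im (w1 i) > 0" "deformed_symbol c 0 z (\<lambda>i. - w1 i) \<noteq> 0" by blast
  obtain V N0 where V: "open V" "convex V" "\<And>i. w0 i \<in> V" "\<And>i. w1 i \<in> V" "\<And>u. u \<in> V \<Longrightarrow> Im u > 0"
    "\<And>N u i. N \<ge> N0 \<Longrightarrow> u \<in> V \<Longrightarrow> Im (z i + of_nat N / u) < 0"
    using exists_common_threshold[of w0 w1 z] w0 w1(1) by blast
  define W where "W s i = w0 i + s * (w1 i - w0 i)" for s i
  define S where "S = (\<Inter>i. (\<lambda>s. W s i) -` V)"
  have S: "W s i \<in> V" if "s \<in> S" for s i using that by (auto simp: S_def)
  show ?thesis
  proof (rule ccontr)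
    assume no: "\<not> ?thesis"
    note obt = that
    \<comment> \<open>Otherwise the deformations with \<open>N > max N0 N1\<close> have no zeros on
      \<open>S\<close>, so the zero of the limit at \<open>s = 0\<close> would spread to
      \<open>s = 1\<close>.\<close>
    have "deformed_symbol c 0 z (\<lambda>i. - W 1 i) = 0"
    proof (rule hurwitz_param[where \<Phi> = "\<lambda>s e. deformed_symbol c e z (\<lambda>i. - W s i)" and S = S and ?s0.0 = 0
          and e = "\<lambda>n. 1 / real (Suc (n + max N0 N1))"])
      show "open S"
        unfolding S_def by (intro open_INT ballI open_vimage V(1)) (auto simp: W_def intro!: continuous_intros)
      have "convex S"
      proof (rule convexI)
        fix s t and u v :: real
        assume st: "s \<in> S" "t \<in> S" and uv: "0 \<le> u" "0 \<le> v" "u + v = 1"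
        have "W (u *\<^sub>R s + v *\<^sub>R t) i = u *\<^sub>R W s i + v *\<^sub>R W t i" for i
        proof -
          have "of_real u + of_real v = (1::complex)" using uv(3) by (metis of_real_add of_real_1)
          then have "w0 i = of_real u * w0 i + of_real v * w0 i" by (metis distrib_right mult_1)
          then show ?thesis by (simp add: W_def scaleR_conv_of_real algebra_simps)
        qed
        then show "u *\<^sub>R s + v *\<^sub>R t \<in> S"
          using convexD[OF V(2) S[OF st(1)] S[OF st(2)] uv] by (auto simp: S_def)
      qed
      then show "connected S" by (rule convex_connected)
      show "continuous_on UNIV (\<lambda>x. deformed_symbol c (snd x) z (\<lambda>i. - W (fst x) i))"
        unfolding deformed_symbol_def W_def by (intro continuous_intros)
      show "(\<lambda>s. deformed_symbol c e z (\<lambda>i. - W s i)) holomorphic_on S" for e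
        unfolding deformed_symbol_def W_def by (intro holomorphic_intros)
      have "(\<lambda>n. 1 / real (Suc n)) \<longlonglongrightarrow> 0"
        using LIMSEQ_inverse_real_of_nat by (simp add: inverse_eq_divide)
      from LIMSEQ_ignore_initial_segment[OF this, of "max N0 N1"]
      show "(\<lambda>n. 1 / real (Suc (n + max N0 N1))) \<longlonglongrightarrow> 0" .
      show "deformed_symbol c (1 / real (Suc (n + max N0 N1))) z (\<lambda>i. - W s i) \<noteq> 0" if "s \<in> S" for n s
      proof
        assume d: "deformed_symbol c (1 / real (Suc (n + max N0 N1))) z (\<lambda>i. - W s i) = 0"
        have "Im (W s i) > 0" "Im (z i + of_nat (Suc (n + max N0 N1)) / W s i) < 0" for i
          by (rule V(5)[OF S[OF \<open>s \<in> S\<close>]], rule V(6)[OF _ S[OF \<open>s \<in> S\<close>]], simp)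
        then show False using no obt[of "Suc (n + max N0 N1)" "W s"] d by (auto simp del: of_nat_Suc)
      qed
    qed (use V 0 in \<open>auto simp: S_def W_def\<close>)
    then show False using w1 by (simp add: W_def)
  qed
qed

lemma symbol_nonzero:
  fixes c :: "'n::finite mexp \<times> 'n mexp \<Rightarrow>\<^sub>0 real"
  assumes T: "\<And>f. f \<in> Hs \<Longrightarrow> weyl_op c f \<in> Hs \<union> {0}"
    and "c \<noteq> 0" and z: "\<And>i. Im (z i) \<ge> 0" and w0: "\<And>i. Im (w0 i) > 0"
  shows "deformed_symbol c 0 z (\<lambda>i. - w0 i) \<noteq> 0"
proof
  assume 0: "deformed_symbol c 0 z (\<lambda>i. - w0 i) = 0"
  let ?K = "Poly_Mapping.keys c"
  let ?L = "Poly_Mapping.lookup"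
  define D where "D = Max ((\<lambda>(p, i). ?L (snd p) i) ` (?K \<times> UNIV))"
  have D: "?L (snd p) i \<le> D" if "p \<in> ?K" for p i
    unfolding D_def using that by (intro Max_ge) (auto intro!: rev_image_eqI[of "(p, i)"])
  \<comment> \<open>The bound is \<open>(D + 1) + D + (D + 1)\<close>: room in \<open>P1\<close> for
    the factors with roots \<open>\<zeta> i\<close>, \<open>z' i\<close> and
    \<open>z i\<close>.\<close>
  obtain N w where N: "N \<ge> 3 * D + 2" "N > 0" and w: "\<And>i. Im (w i) > 0"
    "\<And>i. Im (z i + of_nat N / w i) < 0" "deformed_symbol c (1 / real N) z (\<lambda>i. - w i) = 0"
    using deformed_symbol_zero[OF w0 0] by blast
  define \<zeta> where "\<zeta> i = z i + of_nat N / w i" for i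
  have \<zeta>: "Im (\<zeta> i) < 0" for i using w(2) by (simp add: \<zeta>_def)
  \<comment> \<open>Up to a constant factor this is
    \<open>(1 - (x - z i) * w i / N) ^ N\<close>.\<close>
  define P0 where "P0 i = [:- \<zeta> i, 1:] ^ N" for i

  have "?K \<noteq> {}" using \<open>c \<noteq> 0\<close> by simp
  define ord where "ord p = (\<Sum>i\<in>UNIV. ?L (snd p) i)" for p :: "'n mexp \<times> 'n mexp"
  obtain p0 where p0: "p0 \<in> ?K" "\<And>p. p \<in> ?K \<Longrightarrow> ord p \<le> ord p0"
  proof -
    have "Max (ord ` ?K) \<in> ord ` ?K" using \<open>?K \<noteq> {}\<close> by (intro Max_in) auto
    then obtain p0 where "p0 \<in> ?K" "Max (ord ` ?K) = ord p0" by auto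
    then show ?thesis using that[of p0] by (metis Max_ge finite_imageI finite_keys imageI)
  qed
  define \<beta> where "\<beta> = snd p0"
  have \<beta>D: "?L \<beta> i \<le> D" for i using D[OF p0(1)] by (simp add: \<beta>_def)
  \<comment> \<open>Avoiding \<open>\<zeta> i\<close> and \<open>z i\<close> keeps the remaining
    factors of \<open>P1 i\<close> nonzero at \<open>z' i\<close>.\<close>
  obtain z' where z': "\<And>i. z' i \<notin> {\<zeta> i, z i}"
    "(\<Sum>p\<in>{p\<in>?K. snd p = \<beta>}. of_real (?L c p) * mpower z' (fst p)) \<noteq> 0"
    using exists_coefficient_nonzero[of "fst p0" \<beta> c "\<lambda>i. {\<zeta> i, z i}"] p0(1) by (auto simp: \<beta>_def)
  \<comment> \<open>The derivative \<open>\<partial>\<^sup>\<gamma>\<close> of this product vanishes at \<open>z'\<close> unless \<open>\<gamma> \<ge> \<beta>\<close>, so among the terms of the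
    operator, by the maximality of \<open>\<beta>\<close>, only those with \<open>\<partial>\<^sup>\<beta>\<close> contribute at \<open>z'\<close>.\<close>
  define P1 where "P1 i = [:- z' i, 1:] ^ ?L \<beta> i * ([:- \<zeta> i, 1:] ^ (N - Suc D - ?L \<beta> i) * [:- z i, 1:] ^ Suc D)" for i

  have expo: "N = ?L \<beta> i + (N - Suc D - ?L \<beta> i + Suc D)" "N - Suc D - ?L \<beta> i \<ge> Suc D" for i
    using N(1) \<beta>D[of i] by auto
  have deg: "degree (P0 i) \<le> N" "degree (P1 i) \<le> N" for i
  proof -
    have d: "degree ([:- a, 1:] ^ k) = k" for a :: complex and k by (simp add: degree_power_eq)
    show "degree (P0 i) \<le> N" by (simp only: P0_def d order_refl)
    have "degree (P1 i) \<le> ?L \<beta> i + (N - Suc D - ?L \<beta> i + Suc D)"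
      unfolding P1_def by (intro order_trans[OF degree_mult_le] add_mono) (simp_all only: d order_refl)
    then show "degree (P1 i) \<le> N" using expo(1)[of i] by simp
  qed
  define h0 h1 where "h0 x = (\<Prod>i\<in>UNIV. poly (P0 i) (x i))" and "h1 x = (\<Prod>i\<in>UNIV. poly (P1 i) (x i))" for x
  define Th where "Th P x = (\<Sum>m\<in>box N. sep_coeff P m * weyl_mono c m x)" for P x
  have Th: "Th P x = (\<Sum>p\<in>?K. of_real (?L c p) * mpower x (fst p) *
      (\<Prod>i\<in>UNIV. poly ((pderiv ^^ ?L (snd p) i) (P i)) (x i)))" if "\<And>i. degree (P i) \<le> N" for P x
    unfolding Th_def by (rule sum_sep_coeff_weyl_mono[OF that])

  have dvd: "[:- \<zeta> i, 1:] ^ Suc D dvd P0 i" "[:- \<zeta> i, 1:] ^ Suc D dvd P1 i" "[:- z i, 1:] ^ Suc D dvd P1 i" for i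
  proof -
    show "[:- \<zeta> i, 1:] ^ Suc D dvd P0 i" unfolding P0_def using N(1) by (intro le_imp_power_dvd) simp
    have "[:- \<zeta> i, 1:] ^ Suc D dvd [:- \<zeta> i, 1:] ^ (N - Suc D - ?L \<beta> i)"
      using expo(2)[of i] by (rule le_imp_power_dvd)
    then show "[:- \<zeta> i, 1:] ^ Suc D dvd P1 i" unfolding P1_def by (intro dvd_mult dvd_mult2)
    show "[:- z i, 1:] ^ Suc D dvd P1 i" unfolding P1_def by (intro dvd_mult dvd_refl)
  qed
  \<comment> \<open>No term of the operator differentiates more than \<open>D\<close> times in any
    variable, so zeros of multiplicity \<open>D + 1\<close> survive.\<close>
  have vanish: "Th P x = 0" if "\<And>i. degree (P i) \<le> N" "\<And>i. [:- x i, 1:] ^ Suc D dvd P i" for P x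
  proof -
    have "(\<Prod>i\<in>UNIV. poly ((pderiv ^^ ?L (snd p) i) (P i)) (x i)) = 0" if "p \<in> ?K" for p
      using poly_higher_pderiv_eq_0[OF \<open>\<And>i. [:- x i, 1:] ^ Suc D dvd P i\<close>] D[OF that]
      by (intro prod_zero) (auto simp: less_Suc_eq_le)
    then show ?thesis unfolding Th[OF that(1)] by (intro sum.neutral ballI) (simp only: mult_zero_right)
  qed
  have "Th P0 z = (\<Prod>i\<in>UNIV. (z i - \<zeta> i) ^ N) * deformed_symbol c (1 / real N) z (\<lambda>i. - w i)"
  proof -
    have "poly ((pderiv ^^ ?L (snd p) i) (P0 i)) (z i) = (z i - \<zeta> i) ^ N *
        ((\<Prod>l<?L (snd p) i. of_real (1 - real l * (1 / real N))) * (- w i) ^ ?L (snd p) i)" if "p \<in> ?K" for p i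
      unfolding P0_def
    proof (rule poly_higher_pderiv_linear_power)
      show "?L (snd p) i \<le> N" using D[OF that, of i] N(1) by simp
      show "w i \<noteq> 0" using w(1)[of i] by auto
    qed (use N(2) in \<open>auto simp: \<zeta>_def\<close>)
    then have "Th P0 z = (\<Sum>p\<in>?K. of_real (?L c p) * mpower z (fst p) * (\<Prod>i\<in>UNIV. (z i - \<zeta> i) ^ N *
        ((\<Prod>l<?L (snd p) i. of_real (1 - real l * (1 / real N))) * (- w i) ^ ?L (snd p) i)))"
      unfolding Th[OF deg(1)] by (intro sum.cong refl arg_cong2[where f = "(*)"] prod.cong) auto
    then show ?thesis
      by (simp only: deformed_symbol_def sum_distrib_left prod.distrib[of _ _ UNIV] mult_ac)
  qed
  then have Th0z: "Th P0 z = 0" using w(3) by simp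

  \<comment> \<open>At \<open>z\<close> the image of \<open>P0\<close> vanishes by the choice of
    \<open>w\<close> and that of \<open>P1\<close> by its factor with root \<open>z i\<close>; at
    \<open>\<zeta>\<close> both vanish by multiplicity. What remains as a condition is the absence
    of zeros in the closed upper half-space.\<close>
  have van: "Th P0 x + of_real e * Th P1 x = 0"
    if nz: "\<And>x. (\<And>i. Im (x i) \<ge> 0) \<Longrightarrow> h0 x + of_real e * h1 x \<noteq> 0" for e :: real and x
  proof -
    let ?C = "\<lambda>m. sep_coeff P0 m + of_real e * sep_coeff P1 m"
    have ThC: "Th P0 x + of_real e * Th P1 x = (\<Sum>m\<in>box N. ?C m * weyl_mono c m x)" for x
      by (simp add: Th_def sum_distrib_left sum.distrib[symmetric] distrib_right mult.assoc)
    show ?thesis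
      unfolding ThC
    proof (rule weyl_op_vanish[where h = "\<lambda>x. h0 x + of_real e * h1 x" and z = z and \<zeta> = \<zeta>])
      show "(\<lambda>x. h0 x + of_real e * h1 x) = (\<lambda>x. \<Sum>m\<in>box N. ?C m * mpower x m)"
        using sum_sep_coeff_mpower[of P0 N, OF deg(1)] sum_sep_coeff_mpower[of P1 N, OF deg(2)]
        by (simp add: h0_def h1_def sum_distrib_left[symmetric] sum.distrib distrib_right mult.assoc)
      show "\<exists>t. h0 (\<lambda>i. of_real (a $ i) + of_real (v $ i) * t) +
          of_real e * h1 (\<lambda>i. of_real (a $ i) + of_real (v $ i) * t) = 0"
        if "\<And>i. v $ i > 0" for a v :: "real^'n"
      proof -
        \<comment> \<open>Any variable serves: the line meets the hyperplane where coordinate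
          \<open>j\<close> equals \<open>\<zeta> j\<close>, on which \<open>h0\<close> and
          \<open>h1\<close> both vanish.\<close>
        define j :: 'n where "j = undefined"
        define t where "t = (\<zeta> j - of_real (a $ j)) / of_real (v $ j)"
        have t: "of_real (a $ j) + of_real (v $ j) * t = \<zeta> j" using that[of j] by (simp add: t_def)
        have "poly (P0 j) (\<zeta> j) = 0" "poly (P1 j) (\<zeta> j) = 0"
          using poly_higher_pderiv_eq_0[OF dvd(1), of 0] poly_higher_pderiv_eq_0[OF dvd(2), of 0] by simp_all
        then have "h0 (\<lambda>i. of_real (a $ i) + of_real (v $ i) * t) = 0"
            "h1 (\<lambda>i. of_real (a $ i) + of_real (v $ i) * t) = 0"
          unfolding h0_def h1_def by (auto intro!: exI[of _ j] simp: t)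
        then show ?thesis by (intro exI[of _ t]) simp
      qed
      show "(\<Sum>m\<in>box N. ?C m * weyl_mono c m z) = 0"
        unfolding ThC[symmetric] using Th0z vanish[OF deg(2) dvd(3)] by simp
      show "(\<Sum>m\<in>box N. ?C m * weyl_mono c m \<zeta>) = 0"
        unfolding ThC[symmetric] using vanish[OF deg(1) dvd(1)] vanish[OF deg(2) dvd(2)] by simp
    qed (use T nz z \<zeta> in auto)
  qed

  have h0nz: "h0 x \<noteq> 0" if "\<And>i. Im (x i) \<ge> 0" for x
  proof -
    have "x i \<noteq> \<zeta> i" for i using that[of i] \<zeta>[of i] by auto
    then show ?thesis by (simp add: h0_def P0_def poly_power)
  qed
  have Th0: "Th P0 x = 0" for x using van[of 0 x] h0nz by simp
  \<comment> \<open>Each of the \<open>N\<close> linear factors of \<open>P1 i\<close> is at most a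
    multiple of \<open>t - \<zeta> i\<close> in modulus, and \<open>P0 i\<close> has
    \<open>N\<close> factors too.\<close>
  obtain B where B: "B > 0" "\<And>x. (\<And>i. Im (x i) \<ge> 0) \<Longrightarrow> cmod (h1 x) \<le> B * cmod (h0 x)"
  proof -
    have "\<exists>B>0. \<forall>t. Im t \<ge> 0 \<longrightarrow> cmod (poly (P1 i) t) \<le> B * cmod (poly (P0 i) t)" for i
    proof -
      obtain B1 where B1: "B1 > 0" "\<And>t. Im t \<ge> 0 \<Longrightarrow> cmod (t - z' i) \<le> B1 * cmod (t - \<zeta> i)"
        using linear_factor_bound[OF \<zeta>] by blast
      obtain B2 where B2: "B2 > 0" "\<And>t. Im t \<ge> 0 \<Longrightarrow> cmod (t - z i) \<le> B2 * cmod (t - \<zeta> i)"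
        using linear_factor_bound[OF \<zeta>] by blast
      have "cmod (poly (P1 i) t) \<le> B1 ^ ?L \<beta> i * B2 ^ Suc D * cmod (poly (P0 i) t)" if t: "Im t \<ge> 0" for t
      proof -
        define r where "r = cmod (t - \<zeta> i)"
        have "cmod (poly (P1 i) t) = cmod (t - z' i) ^ ?L \<beta> i * (r ^ (N - Suc D - ?L \<beta> i) * cmod (t - z i) ^ Suc D)"
          by (simp add: P1_def r_def norm_mult norm_power poly_power del: power_Suc)
        also have "\<dots> \<le> (B1 * r) ^ ?L \<beta> i * (r ^ (N - Suc D - ?L \<beta> i) * (B2 * r) ^ Suc D)"
          using B1(2)[OF t] B2(2)[OF t] B1(1) by (intro mult_mono power_mono mult_nonneg_nonneg zero_le_power) (auto simp: r_def)
        also have "\<dots> = B1 ^ ?L \<beta> i * B2 ^ Suc D * r ^ (?L \<beta> i + (N - Suc D - ?L \<beta> i + Suc D))"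
          by (simp only: power_mult_distrib power_add mult_ac)
        also have "?L \<beta> i + (N - Suc D - ?L \<beta> i + Suc D) = N" using expo(1)[of i] by simp
        finally show ?thesis by (simp add: P0_def r_def norm_power poly_power)
      qed
      moreover have "B1 ^ ?L \<beta> i * B2 ^ Suc D > 0" using B1(1) B2(1) by simp
      ultimately show ?thesis by blast
    qed
    then obtain Bi where Bi: "\<And>i. Bi i > 0"
      "\<And>i t. Im t \<ge> 0 \<Longrightarrow> cmod (poly (P1 i) t) \<le> Bi i * cmod (poly (P0 i) t)" by metis
    show ?thesis
    proof (rule that)
      show "(\<Prod>i\<in>UNIV. Bi i) > 0" using Bi(1) by (simp add: prod_pos)
      show "cmod (h1 x) \<le> (\<Prod>i\<in>UNIV. Bi i) * cmod (h0 x)" if "\<And>i. Im (x i) \<ge> 0" for x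
        unfolding h0_def h1_def prod_norm[symmetric] prod.distrib[symmetric]
        using Bi(2)[OF that] by (intro prod_mono) auto
    qed
  qed
  \<comment> \<open>This factor keeps the perturbation at most half as large as
    \<open>h0\<close>.\<close>
  have "Th P0 z' + of_real (1 / (2 * B)) * Th P1 z' = 0"
  proof (rule van)
    fix x :: "'n \<Rightarrow> complex" assume x: "\<And>i. Im (x i) \<ge> 0"
    show "h0 x + of_real (1 / (2 * B)) * h1 x \<noteq> 0"
    proof
      assume "h0 x + of_real (1 / (2 * B)) * h1 x = 0"
      then have "h0 x = - (of_real (1 / (2 * B)) * h1 x)" by (simp only: eq_neg_iff_add_eq_0)
      then have "cmod (h0 x) = 1 / (2 * B) * cmod (h1 x)"
        using B(1) by (simp add: norm_mult norm_divide)
      also have "\<dots> \<le> 1 / (2 * B) * (B * cmod (h0 x))"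
        using B(2)[OF x] B(1) by (intro mult_left_mono) auto
      also have "\<dots> = cmod (h0 x) / 2" using B(1) by simp
      finally show False using h0nz[OF x] by simp
    qed
  qed
  then have Th1: "Th P1 z' = 0" using Th0 B(1) by simp

  define G where "G = (\<Prod>i\<in>UNIV. poly ((pderiv ^^ ?L \<beta> i) (P1 i)) (z' i))"
  have zero: "(\<Prod>i\<in>UNIV. poly ((pderiv ^^ ?L (snd p) i) (P1 i)) (z' i)) = 0" if p: "p \<in> ?K" "snd p \<noteq> \<beta>" for p
  proof -
    have "\<exists>i. ?L (snd p) i < ?L \<beta> i"
    proof (rule ccontr)
      assume "\<not> ?thesis"
      then have le: "?L \<beta> i \<le> ?L (snd p) i" for i by (simp add: not_less)
      moreover obtain i where "?L \<beta> i \<noteq> ?L (snd p) i" using p(2) by (metis poly_mapping_eqI)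
      then have "?L \<beta> i < ?L (snd p) i" using le[of i] by simp
      ultimately have "(\<Sum>i\<in>UNIV. ?L \<beta> i) < (\<Sum>i\<in>UNIV. ?L (snd p) i)"
        by (intro sum_strict_mono_ex1) auto
      then show False using p0(2)[OF p(1)] by (simp add: ord_def \<beta>_def)
    qed
    then obtain i where i: "?L (snd p) i < ?L \<beta> i" by blast
    have "[:- z' i, 1:] ^ ?L \<beta> i dvd P1 i" by (simp add: P1_def del: power_Suc)
    from poly_higher_pderiv_eq_0[OF this i] show ?thesis by (intro prod_zero) auto
  qed
  have "Th P1 z' = (\<Sum>p\<in>?K. if snd p = \<beta> then of_real (?L c p) * mpower z' (fst p) * G else 0)"
    unfolding Th[OF deg(2)] by (intro sum.cong) (auto simp: zero G_def)
  also have "\<dots> = (\<Sum>p\<in>{p\<in>?K. snd p = \<beta>}. of_real (?L c p) * mpower z' (fst p) * G)"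
    by (simp add: sum.inter_filter)
  also have "\<dots> = (\<Sum>p\<in>{p\<in>?K. snd p = \<beta>}. of_real (?L c p) * mpower z' (fst p)) * G"
    by (simp add: sum_distrib_right)
  finally have "G = 0" using Th1 z'(2) by simp
  \<comment> \<open>By \<open>poly_higher_pderiv_power_mult\<close> this derivative is a factorial
    times the cofactor at \<open>z' i\<close>, which is nonzero.\<close>
  then obtain i where "poly ((pderiv ^^ ?L \<beta> i) (P1 i)) (z' i) = 0" by (auto simp: G_def)
  then show False
    using z'(1)[of i] unfolding P1_def poly_higher_pderiv_power_mult by (simp add: poly_power)
qed

theorem theorem5p2:
  fixes T :: "'n::finite mpoly_real \<Rightarrow> 'n mpoly_real"
  assumes "T \<in> weyl_algebra"
    and "T \<noteq> (\<lambda>f. 0)"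
    and "T \<in> As"
  shows "\<forall>z w :: complex^'n.
    (\<forall>j. Im (z $ j) \<ge> 0) \<and> (\<forall>k. Im (w $ k) > 0) \<longrightarrow> weyl_symbol T z (- w) \<noteq> 0"
proof (intro allI impI)
  fix z w :: "complex^'n"
  assume zw: "(\<forall>j. Im (z $ j) \<ge> 0) \<and> (\<forall>k. Im (w $ k) > 0)"
  obtain c where c: "T = weyl_op c" using assms(1) by (auto simp: weyl_algebra_def)
  have "c \<noteq> 0" using assms(2) by (auto simp: c weyl_op_def fun_eq_iff)
  moreover have "weyl_op c f \<in> Hs \<union> {0}" if "f \<in> Hs" for f
    using assms(3) that by (auto simp: As_def c)
  ultimately have "deformed_symbol c 0 (($) z) (\<lambda>i. - w $ i) \<noteq> 0"
    using zw by (intro symbol_nonzero) auto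
  moreover have "weyl_symbol T z (- w) = deformed_symbol c 0 (($) z) (\<lambda>i. - w $ i)"
    by (simp add: weyl_symbol_def c deformed_symbol_0 case_prod_unfold mpower_def)
  ultimately show "weyl_symbol T z (- w) \<noteq> 0" by simp
qed

end
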